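(* Let $d\ge 2$ and let $b\in W^{1,1}(\mathbb{T}^d;\mathbb{R}^d)$ be weakly divergence-free. If $u\in L^\infty(\mathbb{T}^d)$ satisfies $\int_{\mathbb{T}^d}u=0$ and $$\int_{\mathbb{T}^d} (\nabla u + b u)\cdot\nabla\phi = 0\qquad\text{for all }\phi\in C^\infty(\mathbb{T}^d),$$ where the term with $\nabla u$ is understood in the sense of distributions, i.e. $\int_{\mathbb{T}^d}\left(-u\,\Delta\phi + b u\cdot\nabla\phi\right)=0$ for all $\phi\in C^\infty(\mathbb{T}^d)$, then $u=0$ (almost everywhere).
   Context: $\mathbb{T}^d=[-1/2,1/2]^d$ denotes the $d$-dimensional periodic torus (opposite faces identified), and all function spaces ($L^p$, $W^{k,p}$, $C^\infty$) are spaces of periodic functions on $\mathbb{T}^d$. A vector field $b\in L^1(\mathbb{T}^d;\mathbb{R}^d)$ is weakly divergence-free if $\int_{\mathbb{T}^d} b\cdot\nabla\phi=0$ for all $\phi\in C^\infty(\mathbb{T}^d)$. *)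

theory Defs
  imports "HOL-Analysis.Analysis"
begin

text \<open>
  A function on the torus is represented by a function on the whole space that is
  1-periodic in every coordinate. Integration over the torus is integration over the
  unit cell; opposite faces of the closed cell overlap only in a null set.
\<close>

definition periodic :: "(real^'n \<Rightarrow> 'b) \<Rightarrow> bool" where
  "periodic f \<longleftrightarrow> (\<forall>i x. f (x + axis i 1) = f x)"

definition torus :: "(real^'n) measure" where
  "torus = lebesgue_on (cbox (\<chi> i. - 1/2) (\<chi> i. 1/2))"

definition partial :: "'n \<Rightarrow> (real^'n \<Rightarrow> real) \<Rightarrow> real^'n \<Rightarrow> real" where
  "partial i f x = frechet_derivative f (at x) (axis i 1)"

definition grad :: "(real^'n \<Rightarrow> real) \<Rightarrow> real^'n \<Rightarrow> real^'n" where
  "grad f x = (\<chi> i. partial i f x)"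

definition laplacian :: "(real^'n \<Rightarrow> real) \<Rightarrow> real^'n \<Rightarrow> real" where
  "laplacian f x = (\<Sum>i\<in>UNIV. partial i (partial i f) x)"

text \<open>
  The list ranges over all multi-indices, written as sequences of directions; the empty
  list gives the function itself. Differentiability of every iterated partial derivative
  also yields their continuity.
\<close>

definition C_infinity :: "(real^'n \<Rightarrow> real) set" where
  "C_infinity = {\<phi>. periodic \<phi> \<and> (\<forall>is x. foldr partial is \<phi> differentiable (at x))}"

text \<open>
  Elements of Lebesgue and Sobolev spaces are representatives, not equivalence classes.
\<close>

definition L_1 :: "(real^'n \<Rightarrow> 'b::euclidean_space) set" where
  "L_1 = {f. periodic f \<and> integrable torus f}"

definition L_infinity :: "(real^'n \<Rightarrow> 'b::euclidean_space) set" where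
  "L_infinity = {f. periodic f \<and> f \<in> borel_measurable torus \<and>
                    (\<exists>C. AE x in torus. norm (f x) \<le> C)}"

definition weak_partial ::
    "'n \<Rightarrow> (real^'n \<Rightarrow> 'b::euclidean_space) \<Rightarrow> (real^'n \<Rightarrow> 'b) \<Rightarrow> bool" where
  "weak_partial i f g \<longleftrightarrow>
     (\<forall>\<phi>\<in>C_infinity. (LINT x|torus. partial i \<phi> x *\<^sub>R f x) = - (LINT x|torus. \<phi> x *\<^sub>R g x))"

definition W_1_1 :: "(real^'n \<Rightarrow> 'b::euclidean_space) set" where
  "W_1_1 = {f \<in> L_1. \<forall>i. \<exists>g\<in>L_1. weak_partial i f g}"

definition weakly_div_free :: "(real^'n \<Rightarrow> real^'n) \<Rightarrow> bool" where
  "weakly_div_free b \<longleftrightarrow> (\<forall>\<phi>\<in>C_infinity. (LINT x|torus. b x \<bullet> grad \<phi> x) = 0)"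

end

theory Submission
  imports Defs
begin

text \<open>
  For smooth u one would test the equation with u itself: the transport term vanishes since
  b is divergence free, so the gradient of u is zero. A merely bounded u is not an
  admissible test function, so the variables are doubled. Let K be a smooth even periodic kernel. Testing
  the equation in x with K(x - y), multiplying by u(y), integrating over y and symmetrising in x and y
  gives, with the help of the divergence condition, the identity

    \<integral>\<integral> (u(x) - u(y))^2 (b(x) - b(y)) \<bullet> (\<nabla>K)(x - y) = - 4 \<integral>\<integral> u(x) u(y) (\<Delta>K)(x - y)

  (lemma \<open>integral_antisymmetrized_transport\<close>). If the Fourier coefficients of K are nonnegative, each
  frequency contributes a nonnegative amount to the right side. Nonzero frequencies are integer vectors of
  length at least one, and the mean of u is zero; hence the right side is at least
  16 \<pi>^2 \<integral>\<integral> u(x) u(y) K(x - y) (lemma \<open>pos_trig_poincare\<close>). If K runs through an approximate identity, this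
  lower bound tends to 16 \<pi>^2 \<integral> u^2, so it remains to see that the left side tends to zero.

  That is the commutator estimate of DiPerna and Lions (lemma \<open>W11_commutator_tendsto_0\<close>) and the place
  where the weak derivative of b is used. The kernel gradient times the distance |x - y| is bounded in mean,
  so a part of b with small weak gradient contributes little, uniformly in K; after removing it, b may be
  assumed smooth. Then a part of u that is small in mean contributes little as well, and for
  smooth b and u the integrand is of order |x - y|^3 |\<nabla>K(x - y)|, which tends to zero in mean.

  The kernels are normalised powers of the trigonometric polynomial 1 - gap, whose maximum is attained
  exactly on the integer lattice (lemma \<open>mollifier_exists\<close>). All their moment bounds follow from two facts: a power
  of 1 - t absorbs factors of t, and the mass of the powers decays at most polynomially in the exponent, so that
  quadrupling the exponent changes the mass by a bounded factor for infinitely many exponents. As the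
  kernels are trigonometric polynomials, so is everything convolved with them, and it suffices
  to test the equation with such functions.
\<close>

section \<open>Integration over the torus\<close>

abbreviation cell :: "(real^'n) set" where
  "cell \<equiv> cbox (\<chi> i. - 1/2) (\<chi> i. 1/2)"

lemma finite_measure_torus: "finite_measure torus"
  unfolding torus_def by (rule finite_measure_lebesgue_on) simp

interpretation torus: finite_measure torus
  by (rule finite_measure_torus)

interpretation torus2: pair_sigma_finite torus torus ..

interpretation torus2: finite_measure "torus \<Otimes>\<^sub>M torus"
  by (rule finite_measure_pair_measure[OF finite_measure_torus finite_measure_torus])

lemma space_torus: "space torus = cell"
  by (simp add: torus_def)

lemma mem_cell: "x \<in> cell \<longleftrightarrow> (\<forall>i. \<bar>x $ i\<bar> \<le> 1/2)"
proof -
  have "(- 1/2 \<le> t \<and> t \<le> 1/2) = (\<bar>t\<bar> \<le> 1/2)" for t :: real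
    by (auto simp: abs_le_iff)
  then show ?thesis by (simp only: mem_box_cart vec_lambda_beta)
qed

lemma measure_torus: "measure torus (space (torus :: (real^'n) measure)) = 1"
proof -
  have "(\<chi> i. - 1/2) \<in> (cell :: (real^'n) set)"
    by (simp add: mem_box_cart)
  then have "cell \<noteq> ({} :: (real^'n) set)"
    by blast
  from content_cbox_cart[OF this] show ?thesis
    by (simp add: torus_def measure_restrict_space)
qed

lemma measurable_ident_torus [measurable]: "(\<lambda>x. x) \<in> torus \<rightarrow>\<^sub>M (borel :: (real^'n) measure)"
  unfolding torus_def by (intro continuous_imp_measurable_on_sets_lebesgue continuous_intros) auto

lemma continuous_measurable_torus:
  fixes h :: "real^'n \<Rightarrow> real"
  assumes "continuous_on UNIV h"
  shows "h \<in> borel_measurable torus"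
proof -
  have "h \<in> borel_measurable borel"
    using assms by (rule borel_measurable_continuous_onI)
  from measurable_compose[OF measurable_ident_torus this] show ?thesis .
qed

lemma continuous_integrable_torus:
  fixes h :: "real^'n \<Rightarrow> real"
  assumes "continuous_on UNIV h"
  shows "integrable torus h"
  unfolding torus_def
  by (rule continuous_imp_integrable) (use assms continuous_on_subset in blast)

lemma diff_measurable_torus2:
  fixes h :: "real^'n \<Rightarrow> real"
  assumes "continuous_on UNIV h"
  shows "(\<lambda>(x, y). h (x - y)) \<in> borel_measurable (torus \<Otimes>\<^sub>M torus)"
proof -
  have [measurable]: "h \<in> borel_measurable borel"
    using assms by (rule borel_measurable_continuous_onI)
  show ?thesis by measurable
qed

lemma integrable_mult_bounded:
  fixes f h :: "'a \<Rightarrow> real"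
  assumes "integrable M f" and [measurable]: "h \<in> borel_measurable M" and "\<And>x. \<bar>h x\<bar> \<le> B"
  shows "integrable M (\<lambda>x. f x * h x)"
proof (rule Bochner_Integration.integrable_bound)
  show "integrable M (\<lambda>x. B * f x)" using assms(1) by simp
  show "(\<lambda>x. f x * h x) \<in> borel_measurable M" using assms(1) by measurable
  have "0 \<le> B" using assms(3)[of undefined] by linarith
  show "AE x in M. norm (f x * h x) \<le> norm (B * f x)"
    using assms(3) \<open>0 \<le> B\<close>
    by (intro AE_I2) (simp add: abs_mult mult.commute[of B] mult_left_mono)
qed

lemma bounded_integrable_torus:
  fixes u :: "real^'n \<Rightarrow> real"
  assumes "u \<in> borel_measurable torus" "\<And>x. \<bar>u x\<bar> \<le> U"
  shows "integrable torus u"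
  by (rule torus.integrable_const_bound[where B = U]) (use assms in auto)

lemma continuous_scaleR_integrable:
  fixes \<psi> :: "real^'n \<Rightarrow> real" and f :: "real^'n \<Rightarrow> 'b::euclidean_space"
  assumes "continuous_on UNIV \<psi>" "integrable torus f"
  shows "integrable torus (\<lambda>x. \<psi> x *\<^sub>R f x)"
proof -
  have "bounded (\<psi> ` cell)"
    by (intro compact_imp_bounded compact_continuous_image compact_cbox continuous_on_subset[OF assms(1)]) simp
  then obtain B where B: "\<And>x. x \<in> cell \<Longrightarrow> \<bar>\<psi> x\<bar> \<le> B"
    unfolding bounded_iff by auto
  note [measurable] = continuous_measurable_torus[OF assms(1)]
  have [measurable]: "f \<in> borel_measurable torus" using assms(2) by simp
  show ?thesis
  proof (rule Bochner_Integration.integrable_bound)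
    show "integrable torus (\<lambda>x. B *\<^sub>R f x)" using assms(2) by simp
    show "AE x in torus. norm (\<psi> x *\<^sub>R f x) \<le> norm (B *\<^sub>R f x)"
      by (rule AE_I2) (use B in \<open>force simp: space_torus intro!: mult_right_mono order_trans[OF _ abs_ge_self]\<close>)
  qed measurable
qed

text \<open>
  Every double integral below has the form of a bounded continuous kernel in the difference,
  weighted by two integrable functions of one variable each; this is Fubini's theorem for them.
\<close>

lemma
  fixes f g h :: "real^'n \<Rightarrow> real"
  assumes f: "integrable torus f" and g: "integrable torus g"
    and h: "continuous_on UNIV h" "\<And>x. \<bar>h x\<bar> \<le> B"
  shows convolution_integrable: "integrable (torus \<Otimes>\<^sub>M torus) (\<lambda>(x, y). f x * g y * h (x - y))"
    and convolution_fst: "(\<integral>(x, y). f x * g y * h (x - y) \<partial>(torus \<Otimes>\<^sub>M torus))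
          = (LINT x|torus. f x * (LINT y|torus. g y * h (x - y)))"
    and convolution_snd: "(\<integral>(x, y). f x * g y * h (x - y) \<partial>(torus \<Otimes>\<^sub>M torus))
          = (LINT y|torus. g y * (LINT x|torus. f x * h (x - y)))"
proof -
  have [measurable]: "f \<in> borel_measurable torus" "g \<in> borel_measurable torus"
    using f g by auto
  have "integrable (torus \<Otimes>\<^sub>M torus) (\<lambda>(x, y). f x * g y)"
  proof (rule torus2.Fubini_integrable)
    show "integrable torus (\<lambda>x. LINT y|torus. norm (case (x, y) of (x, y) \<Rightarrow> f x * g y))"
      using f by (simp add: abs_mult)
    show "AE x in torus. integrable torus (\<lambda>y. case (x, y) of (x, y) \<Rightarrow> f x * g y)"
      using g by simp
  qed measurable
  from integrable_mult_bounded[OF this diff_measurable_torus2[OF h(1)], of B]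
  show int: "integrable (torus \<Otimes>\<^sub>M torus) (\<lambda>(x, y). f x * g y * h (x - y))"
    using h(2) by (simp add: case_prod_beta')
  show "(\<integral>(x, y). f x * g y * h (x - y) \<partial>(torus \<Otimes>\<^sub>M torus))
          = (LINT x|torus. f x * (LINT y|torus. g y * h (x - y)))"
    using torus2.integral_fst[OF int] by (simp add: mult.assoc)
  have "(\<lambda>x. f x * g y * h (x - y)) = (\<lambda>x. g y * (f x * h (x - y)))" for y
    by (simp add: mult_ac)
  then show "(\<integral>(x, y). f x * g y * h (x - y) \<partial>(torus \<Otimes>\<^sub>M torus))
          = (LINT y|torus. g y * (LINT x|torus. f x * h (x - y)))"
    using torus2.integral_snd[OF int] by simp
qed

lemma
  fixes f :: "real^'n \<Rightarrow> real"
  assumes f: "integrable torus f"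
  shows integrable_torus2_fst: "integrable (torus \<Otimes>\<^sub>M (torus :: (real^'n) measure)) (\<lambda>(x, y). f x)"
    and integral_torus2_fst: "(\<integral>(x, y). f x \<partial>(torus \<Otimes>\<^sub>M (torus :: (real^'n) measure))) = (LINT x|torus. f x)"
    and integrable_torus2_snd: "integrable ((torus :: (real^'n) measure) \<Otimes>\<^sub>M torus) (\<lambda>(x, y). f y)"
    and integral_torus2_snd: "(\<integral>(x, y). f y \<partial>((torus :: (real^'n) measure) \<Otimes>\<^sub>M torus)) = (LINT x|torus. f x)"
proof -
  have one: "integrable torus (\<lambda>x::real^'n. 1 :: real)" by simp
  note c = continuous_on_const[of UNIV "1::real"]
  show "integrable (torus \<Otimes>\<^sub>M (torus :: (real^'n) measure)) (\<lambda>(x, y). f x)"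
    using convolution_integrable[OF f one c, of 1] by simp
  show "(\<integral>(x, y). f x \<partial>(torus \<Otimes>\<^sub>M (torus :: (real^'n) measure))) = (LINT x|torus. f x)"
    using convolution_fst[OF f one c, of 1] by (simp add: measure_torus)
  show "integrable ((torus :: (real^'n) measure) \<Otimes>\<^sub>M torus) (\<lambda>(x, y). f y)"
    using convolution_integrable[OF one f c, of 1] by simp
  show "(\<integral>(x, y). f y \<partial>((torus :: (real^'n) measure) \<Otimes>\<^sub>M torus)) = (LINT x|torus. f x)"
    using convolution_snd[OF one f c, of 1] by (simp add: measure_torus)
qed

lemma periodic_int_shift:
  fixes h :: "real^'n \<Rightarrow> 'b"
  assumes "periodic h"
  shows "h (x + axis i (of_int m)) = h x"
proof -
  have nat: "h (y + axis i (of_nat n)) = h y" for n :: nat and y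
  proof (induction n arbitrary: y)
    case (Suc n)
    have "y + axis i (of_nat (Suc n)) = (y + axis i (of_nat n)) + axis i 1"
      by (simp add: vec_eq_iff axis_def)
    then show ?case using Suc assms by (metis periodic_def)
  qed (simp add: axis_def zero_vec_def[symmetric])
  show ?thesis
  proof (cases "m \<ge> 0")
    case True
    then show ?thesis using nat[of x "nat m"] by simp
  next
    case False
    have "x + axis i (of_int m) + axis i (of_nat (nat (- m))) = x"
      using False by (simp add: vec_eq_iff axis_def)
    then show ?thesis using nat[of "x + axis i (of_int m)" "nat (- m)"] by metis
  qed
qed

lemma integral_torus:
  fixes h :: "real^'n \<Rightarrow> real"
  assumes "continuous_on UNIV h"
  shows "(LINT x|torus. h x) = integral cell h"
  using continuous_integrable_torus[OF assms] unfolding torus_def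
  by (rule lebesgue_integral_eq_integral) simp

text \<open>
  By periodicity the shift may be taken in the unit interval. The shifted cell is cut at the old
  face; the part that sticks out is moved back by one period and fills the gap on the other side.
\<close>

lemma integral_torus_axis_shift:
  fixes h :: "real^'n \<Rightarrow> real"
  assumes per: "periodic h" and cont: "continuous_on UNIV h"
  shows "(LINT x|torus. h (x + axis i t)) = (LINT x|torus. h x)"
proof -
  define s where "s = frac t"
  have s: "0 \<le> s" "s \<le> 1" unfolding s_def using frac_lt_1[of t] by (auto simp: less_imp_le)
  have eq: "h (x + axis i t) = h (axis i s + x)" for x
  proof -
    have "x + axis i t = (axis i s + x) + axis i (of_int \<lfloor>t\<rfloor>)"
      by (simp add: vec_eq_iff axis_def s_def frac_def)
    then show ?thesis using periodic_int_shift[OF per] by metis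
  qed
  define a b :: "real^'n" where "a = (\<chi> i. - 1/2)" and "b = (\<chi> i. 1/2)"
  define m1 where "m1 = (\<chi> j. if j = i then s - 1/2 else (1/2 :: real))"
  define m2 where "m2 = (\<chi> j. if j = i then s - 1/2 else (- 1/2 :: real))"
  have int: "h integrable_on cbox p q" for p q
    using cont by (meson continuous_on_subset integrable_continuous top_greatest)
  have k: "axis i 1 \<in> (Basis :: (real^'n) set)" by (simp add: axis_in_Basis_iff)
  note [simp] = inner_axis
  have sets: "cbox a b \<inter> {x. x \<bullet> axis i 1 \<le> s - 1/2} = cbox a m1"
     "cbox a b \<inter> {x. x \<bullet> axis i 1 \<ge> s - 1/2} = cbox m2 b"
     "cbox (a + axis i s) (b + axis i s) \<inter> {x. x \<bullet> axis i 1 \<le> 1/2} = cbox m2 b"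
     "cbox (a + axis i s) (b + axis i s) \<inter> {x. x \<bullet> axis i 1 \<ge> 1/2} = cbox (a + axis i 1) (m1 + axis i 1)"
    using s unfolding a_def b_def m1_def m2_def inner_axis inner_real_def mult_1_right
      interval_split_cart[unfolded interval_cbox_cart]
    by (auto intro!: arg_cong2[where f = cbox] simp: vec_eq_iff axis_def)
  have "(LINT x|torus. h (x + axis i t)) = integral (cbox a b) (h \<circ> (+) (axis i s))"
    unfolding eq o_def a_def b_def
    by (intro integral_torus continuous_on_compose2[OF cont]) (auto intro!: continuous_intros)
  also have "\<dots> = integral (cbox (a + axis i s) (b + axis i s)) h"
    by (rule integral_shift_cbox_plus)
  also have "\<dots> = integral (cbox m2 b) h + integral (cbox (a + axis i 1) (m1 + axis i 1)) h"
    using integral_split[OF int k, of "a + axis i s" "b + axis i s" "1/2"] by (simp only: sets)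
  also have "integral (cbox (a + axis i 1) (m1 + axis i 1)) h = integral (cbox a m1) (h \<circ> (+) (axis i 1))"
    by (rule integral_shift_cbox_plus[symmetric])
  also have "h \<circ> (+) (axis i 1) = h"
    using per by (auto simp: fun_eq_iff periodic_def add.commute)
  also have "integral (cbox m2 b) h + integral (cbox a m1) h = integral (cbox a b) h"
    using integral_split[OF int k, of a b "s - 1/2"] by (simp only: sets)
  also have "\<dots> = (LINT x|torus. h x)"
    unfolding a_def b_def by (rule integral_torus[OF cont, symmetric])
  finally show ?thesis .
qed

lemma integral_torus_shift:
  fixes h :: "real^'n \<Rightarrow> real"
  assumes per: "periodic h" and cont: "continuous_on UNIV h"
  shows "(LINT x|torus. h (x + a)) = (LINT x|torus. h x)"
proof -
  have "(LINT x|torus. h (x + (\<Sum>i\<in>F. axis i (a $ i)))) = (LINT x|torus. h x)" if "finite F" for F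
    using that
  proof (induction F)
    case (insert i F)
    let ?v = "\<Sum>i\<in>F. axis i (a $ i)"
    have "x + axis j 1 + ?v = x + ?v + axis j 1" for x :: "real^'n" and j
      by simp
    then have "periodic (\<lambda>x. h (x + ?v))"
      using per unfolding periodic_def by metis
    moreover have "continuous_on UNIV (\<lambda>x. h (x + ?v))"
      by (intro continuous_on_compose2[OF cont]) (auto intro!: continuous_intros)
    ultimately have "(LINT x|torus. h ((x + axis i (a $ i)) + ?v)) = (LINT x|torus. h (x + ?v))"
      by (rule integral_torus_axis_shift)
    then show ?case using insert by (simp add: add.assoc)
  qed simp
  from this[of UNIV] have "(LINT x|torus. h (x + (\<Sum>i\<in>UNIV. axis i (a $ i)))) = (LINT x|torus. h x)"
    by simp
  also have "(\<Sum>i\<in>UNIV. axis i (a $ i)) = a"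
    by (simp add: vec_eq_iff axis_def if_distrib[of "\<lambda>f. f _"] sum.If_cases eq_commute)
  finally show ?thesis .
qed

lemma integral_torus_reflect:
  fixes h :: "real^'n \<Rightarrow> real"
  assumes per: "periodic h" and cont: "continuous_on UNIV h"
  shows "(LINT x|torus. h (a - x)) = (LINT x|torus. h x)"
proof -
  have cont': "continuous_on UNIV (\<lambda>x. h (a + x))" "continuous_on UNIV (\<lambda>x. h (a - x))"
    by (rule continuous_on_compose2[OF cont], (auto intro!: continuous_intros)[2])+
  have "(LINT x|torus. h (a - x)) = integral cell (\<lambda>x. h (a + - x))"
    using integral_torus[OF cont'(2)] by simp
  also have "(\<chi> i. - 1/2) = - ((\<chi> i. 1/2) :: real^'n)" "(\<chi> i. 1/2) = - ((\<chi> i. - 1/2) :: real^'n)"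
    by (simp_all add: vec_eq_iff)
  then have "integral cell (\<lambda>x. h (a + - x))
     = integral (cbox (- (\<chi> i. 1/2)) (- (\<chi> i. - 1/2))) (\<lambda>x. h (a + - x))"
    by simp
  also have "\<dots> = integral cell (\<lambda>x. h (a + x))"
    by (rule integral_reflect)
  also have "\<dots> = (LINT x|torus. h (x + a))"
    using integral_torus[OF cont'(1)] by (simp add: add.commute)
  finally show ?thesis using integral_torus_shift[OF per cont] by simp
qed

section \<open>Trigonometric polynomials\<close>

definition wave :: "('n \<Rightarrow> int) \<Rightarrow> real \<Rightarrow> real^'n \<Rightarrow> real" where
  "wave k \<theta> x = cos (2 * pi * (\<Sum>i\<in>UNIV. of_int (k i) * x $ i) + \<theta>)"

text \<open>
  A trigonometric polynomial that is comparable to the squared distance to the integer lattice. It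
  measures all distances on the torus, so that no distance function on the quotient is needed.
\<close>

definition gap :: "real^'n \<Rightarrow> real" where
  "gap x = (\<Sum>i\<in>UNIV. (sin (pi * x $ i))\<^sup>2) / CARD('n)"

text \<open>
  Trigonometric polynomials. They serve as test functions, since they are closed under the
  operations needed, and convolution of any integrable function with one of them is one again.
\<close>

inductive_set trig :: "(real^'n \<Rightarrow> real) set" where
  wave: "(\<lambda>x. c * wave k \<theta> x) \<in> trig"
| add: "f \<in> trig \<Longrightarrow> g \<in> trig \<Longrightarrow> (\<lambda>x. f x + g x) \<in> trig"

lemma partial_eqI: "(f has_derivative f') (at x) \<Longrightarrow> partial i f x = f' (axis i 1)"
  unfolding partial_def by (simp add: frechet_derivative_at[symmetric])

lemma sum_mult_axis: "(\<Sum>j\<in>UNIV. c j * axis i 1 $ j) = (c i :: real)"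
  by (simp add: axis_def if_distrib[of "\<lambda>f. _ * f"] sum.If_cases)

lemma wave_quarter: "wave k (\<theta> + pi / 2) x = - sin (2 * pi * (\<Sum>i\<in>UNIV. of_int (k i) * x $ i) + \<theta>)"
  by (simp add: wave_def cos_add flip: add.assoc)

lemma wave_has_derivative:
  "((\<lambda>x. c * wave k \<theta> x) has_derivative
     (\<lambda>h. \<Sum>i\<in>UNIV. (c * (2 * pi * of_int (k i)) * wave k (\<theta> + pi / 2) x) * h $ i)) (at x)"
proof -
  have nth: "((\<lambda>x. x $ i) has_derivative (\<lambda>h. h $ i)) (at x)" for i and x :: "real^'n"
    by (rule bounded_linear_imp_has_derivative) (rule bounded_linear_vec_nth)
  show ?thesis
    unfolding wave_quarter unfolding wave_def
    by (rule derivative_eq_intros nth refl)+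
      (simp add: fun_eq_iff sum_distrib_left sum_distrib_right mult_ac sum_negf)
qed

lemma partial_wave:
  "partial i (\<lambda>x. c * wave k \<theta> x) = (\<lambda>x. (c * (2 * pi * of_int (k i))) * wave k (\<theta> + pi / 2) x)"
  by (rule ext) (simp add: partial_eqI[OF wave_has_derivative] sum_mult_axis)

lemma trig_derivative:
  assumes "f \<in> trig"
  shows "(\<forall>x. (f has_derivative (\<lambda>h. \<Sum>i\<in>UNIV. partial i f x * h $ i)) (at x)) \<and> (\<forall>i. partial i f \<in> trig)"
  using assms
proof induction
  case (wave c k \<theta>)
  show ?case
    unfolding partial_wave using wave_has_derivative trig.wave by blast
next
  case (add f g)
  have D: "((\<lambda>x. f x + g x) has_derivative
      (\<lambda>h. (\<Sum>i\<in>UNIV. partial i f x * h $ i) + (\<Sum>i\<in>UNIV. partial i g x * h $ i))) (at x)" for x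
    using add.IH by (intro has_derivative_add) auto
  have "partial i (\<lambda>x. f x + g x) = (\<lambda>x. partial i f x + partial i g x)" for i
    by (rule ext) (simp add: partial_eqI[OF D] sum_mult_axis)
  then show ?case
    using D add.IH by (auto simp: sum.distrib distrib_right intro: trig.add)
qed

lemma trig_has_derivative:
  "f \<in> trig \<Longrightarrow> (f has_derivative (\<lambda>h. \<Sum>i\<in>UNIV. partial i f x * h $ i)) (at x)"
  using trig_derivative by blast

lemma trig_partial: "f \<in> trig \<Longrightarrow> partial i f \<in> trig"
  using trig_derivative by blast

lemma partial_add:
  "f \<in> trig \<Longrightarrow> g \<in> trig \<Longrightarrow> partial i (\<lambda>x. f x + g x) = (\<lambda>x. partial i f x + partial i g x)"
  by (rule ext, subst partial_eqI[OF has_derivative_add[OF trig_has_derivative trig_has_derivative]])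
    (simp_all add: sum_mult_axis)

lemma partial_diff:
  "f \<in> trig \<Longrightarrow> g \<in> trig \<Longrightarrow> partial i (\<lambda>x. f x - g x) y = partial i f y - partial i g y"
  by (subst partial_eqI[OF has_derivative_diff[OF trig_has_derivative trig_has_derivative]])
    (simp_all add: sum_mult_axis)

lemma trig_continuous: "f \<in> trig \<Longrightarrow> continuous_on UNIV f"
  by (meson continuous_at_imp_continuous_on has_derivative_continuous trig_has_derivative)

lemma periodic_wave:
  fixes k :: "'n::finite \<Rightarrow> int"
  shows "periodic (wave k \<theta>)"
  unfolding periodic_def
proof (intro allI)
  fix i :: 'n and x :: "real^'n"
  have "(\<Sum>j\<in>UNIV. of_int (k j) * (x + axis i 1) $ j) = (\<Sum>j\<in>UNIV. of_int (k j) * x $ j) + of_int (k i)"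
    by (simp add: distrib_left sum.distrib sum_mult_axis)
  then have "2 * pi * (\<Sum>j\<in>UNIV. of_int (k j) * (x + axis i 1) $ j) + \<theta>
     = (2 * pi * (\<Sum>j\<in>UNIV. of_int (k j) * x $ j) + \<theta>) + 2 * pi * of_int (k i)"
    by (simp add: algebra_simps)
  moreover have "cos (t + 2 * pi * of_int m) = cos t" for t m
    by (simp add: cos_add)
  ultimately show "wave k \<theta> (x + axis i 1) = wave k \<theta> x"
    unfolding wave_def by (simp only:)
qed

lemma trig_periodic: "f \<in> trig \<Longrightarrow> periodic f"
  by (induction rule: trig.induct) (use periodic_wave in \<open>auto simp: periodic_def\<close>)

lemma trig_laplacian:
  assumes "f \<in> trig"
  shows "laplacian f \<in> trig"
proof -
  have "(\<lambda>x. \<Sum>i\<in>A. partial i (partial i f) x) \<in> trig" if "finite A" for A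
    using that
    by (induction A rule: finite_induct)
      (use trig.wave[of 0] in \<open>auto intro!: trig.add trig_partial \<open>f \<in> trig\<close>\<close>)
  from this[of UNIV] show ?thesis unfolding laplacian_def[abs_def] by simp
qed

lemma trig_C_infinity: "f \<in> trig \<Longrightarrow> f \<in> C_infinity"
proof -
  assume f: "f \<in> trig"
  have "foldr partial is f \<in> trig" for "is"
    by (induction "is") (auto simp: f intro: trig_partial)
  then show ?thesis
    unfolding C_infinity_def differentiable_def using trig_has_derivative trig_periodic[OF f] by blast
qed

lemma trig_bounded:
  assumes "f \<in> trig"
  obtains B where "0 < B" "\<And>x. \<bar>f x\<bar> \<le> B"
proof -
  have "\<exists>B. \<forall>x. \<bar>f x\<bar> \<le> B"
    using assms
  proof induction
    case (wave c k \<theta>)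
    have "\<bar>c * wave k \<theta> x\<bar> \<le> \<bar>c\<bar>" for x
      using mult_left_mono[OF abs_cos_le_one, of "\<bar>c\<bar>"] by (simp add: wave_def abs_mult)
    then show ?case by blast
  next
    case (add f g)
    then obtain B C where "\<bar>f x\<bar> \<le> B" "\<bar>g x\<bar> \<le> C" for x by blast
    then have "\<bar>f x + g x\<bar> \<le> B + C" for x
      using abs_triangle_ineq add_mono order_trans by meson
    then show ?case by blast
  qed
  then obtain B where B: "\<bar>f x\<bar> \<le> B" for x by blast
  show ?thesis
    by (rule that[of "max 1 B"]) (auto intro: max.coboundedI2[OF B])
qed

lemma trig_cmult: "f \<in> trig \<Longrightarrow> (\<lambda>x. c * f x) \<in> trig"
proof (induction rule: trig.induct)
  case (wave b k \<theta>)
  show ?case using trig.wave[of "c * b"] by (simp add: mult.assoc)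
next
  case (add f g)
  then show ?case using trig.add by (simp add: distrib_left)
qed

lemma trig_diff: "f \<in> trig \<Longrightarrow> g \<in> trig \<Longrightarrow> (\<lambda>x. f x - g x) \<in> trig"
  using trig.add[OF _ trig_cmult[of g "- 1"], of f] by simp

lemma trig_shift: "f \<in> trig \<Longrightarrow> (\<lambda>x. f (x + a)) \<in> trig"
proof (induction rule: trig.induct)
  case (wave b k \<theta>)
  have "wave k \<theta> (x + a) = wave k (\<theta> + 2 * pi * (\<Sum>i\<in>UNIV. of_int (k i) * a $ i)) x" for x
    unfolding wave_def by (simp add: distrib_left sum.distrib add_ac)
  then show ?case by (simp add: trig.wave)
qed (auto intro: trig.add)

lemma trig_reflect: "f \<in> trig \<Longrightarrow> (\<lambda>x. f (- x)) \<in> trig"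
proof (induction rule: trig.induct)
  case (wave b k \<theta>)
  have "wave k \<theta> (- x) = wave (\<lambda>i. - k i) \<theta> x" for x
    unfolding wave_def by (simp add: sum_negf)
  then show ?case by (simp add: trig.wave)
qed (auto intro: trig.add)

lemma trig_reflect_shift:
  assumes "f \<in> trig"
  shows "(\<lambda>x. f (a - x)) \<in> trig"
  using trig_reflect[OF trig_shift[OF assms, of a]] by simp

lemma partial_shift:
  assumes "f \<in> trig"
  shows "partial i (\<lambda>x. f (x - a)) = (\<lambda>x. partial i f (x - a))"
proof (rule ext)
  fix x
  have "((\<lambda>x. f (x - a)) has_derivative (\<lambda>h. \<Sum>i\<in>UNIV. partial i f (x - a) * h $ i)) (at x)"
    by (rule has_derivative_compose[OF _ trig_has_derivative[OF assms], of "\<lambda>x. x - a" "\<lambda>h. h"])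
      (auto intro!: derivative_eq_intros)
  from partial_eqI[OF this] show "partial i (\<lambda>x. f (x - a)) x = partial i f (x - a)"
    by (simp add: sum_mult_axis)
qed

lemma partial_reflect_shift:
  assumes "f \<in> trig"
  shows "partial i (\<lambda>x. f (a - x)) = (\<lambda>x. - partial i f (a - x))"
proof (rule ext)
  fix x
  have "((\<lambda>x. f (a - x)) has_derivative (\<lambda>h. \<Sum>i\<in>UNIV. partial i f (a - x) * (- h) $ i)) (at x)"
    by (rule has_derivative_compose[OF _ trig_has_derivative[OF assms], of "\<lambda>x. a - x" "\<lambda>h. - h"])
      (auto intro!: derivative_eq_intros)
  from partial_eqI[OF this] show "partial i (\<lambda>x. f (a - x)) x = - partial i f (a - x)"
    by (simp add: sum_mult_axis sum_negf)
qed

lemma gap_nonneg: "0 \<le> gap x"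
  unfolding gap_def by (auto intro!: divide_nonneg_nonneg sum_nonneg)

lemma gap_le_1: "gap (x :: real^'n) \<le> 1"
proof -
  have "(\<Sum>i\<in>(UNIV::'n set). (sin (pi * x $ i))\<^sup>2) \<le> (\<Sum>i\<in>(UNIV::'n set). 1)"
    by (intro sum_mono) (simp add: abs_square_le_1)
  then show ?thesis unfolding gap_def by simp
qed

lemma abs_sin_le_gap: "\<bar>sin (pi * x $ i)\<bar> \<le> sqrt CARD('n) * sqrt (gap (x :: real^'n))"
proof -
  have "(sin (pi * x $ i))\<^sup>2 \<le> (\<Sum>i\<in>UNIV. (sin (pi * x $ i))\<^sup>2)"
    by (rule member_le_sum) auto
  also have "\<dots> = CARD('n) * gap x"
    by (simp add: gap_def)
  finally have "sqrt ((sin (pi * x $ i))\<^sup>2) \<le> sqrt (CARD('n) * gap x)"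
    by (rule real_sqrt_le_mono)
  then show ?thesis by (simp add: real_sqrt_mult)
qed

lemma abs_sin_sum_le: "finite A \<Longrightarrow> \<bar>sin (sum f A)\<bar> \<le> (\<Sum>i\<in>A. \<bar>sin (f i :: real)\<bar>)"
proof (induction A rule: finite_induct)
  case (insert i A)
  have "\<bar>sin (f i + sum f A)\<bar> \<le> \<bar>sin (f i)\<bar> * \<bar>cos (sum f A)\<bar> + \<bar>cos (f i)\<bar> * \<bar>sin (sum f A)\<bar>"
    unfolding sin_add by (metis abs_mult abs_triangle_ineq)
  also have "\<dots> \<le> \<bar>sin (f i)\<bar> * 1 + 1 * \<bar>sin (sum f A)\<bar>"
    by (intro add_mono mult_mono) auto
  finally show ?case using insert by simp
qed simp

lemma abs_sin_of_nat_mult_le: "\<bar>sin (of_nat n * t)\<bar> \<le> of_nat n * \<bar>sin (t :: real)\<bar>"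
  using abs_sin_sum_le[of "{..<n}" "\<lambda>_. t"] by simp

lemma abs_sin_of_int_mult_le: "\<bar>sin (of_int m * t)\<bar> \<le> \<bar>of_int m\<bar> * \<bar>sin (t :: real)\<bar>"
  using abs_sin_of_nat_mult_le[of "nat \<bar>m\<bar>" t] by (cases "m \<ge> 0") auto

text \<open>
  Trigonometric polynomials are Lipschitz for the distance of the torus. For a single wave the
  difference of two values is controlled by the sine of half the phase difference, and that
  half is an integer combination of pi times the coordinates, so subadditivity of the absolute value
  of the sine reduces everything to single coordinates.
\<close>

lemma trig_gap_lipschitz:
  fixes f :: "real^'n \<Rightarrow> real"
  assumes "f \<in> trig"
  obtains L where "0 < L" "\<And>x y. \<bar>f x - f y\<bar> \<le> L * sqrt (gap (x - y))"
proof -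
  have "\<exists>L. \<forall>x y. \<bar>f x - f y\<bar> \<le> L * sqrt (gap (x - y))"
    using assms
  proof induction
    case (wave c k \<theta>)
    define L where "L = \<bar>c\<bar> * 2 * (\<Sum>i\<in>UNIV. \<bar>of_int (k i)\<bar> * sqrt CARD('n))"
    have "\<bar>c * wave k \<theta> x - c * wave k \<theta> y\<bar> \<le> L * sqrt (gap (x - y))" for x y
    proof -
      let ?S = "\<lambda>x. \<Sum>i\<in>UNIV. of_int (k i) * x $ i"
      have diff: "?S x - ?S y = ?S (x - y)"
        by (simp add: right_diff_distrib sum_subtractf)
      have "wave k \<theta> x - wave k \<theta> y = 2 * sin (((2 * pi * ?S x + \<theta>) + (2 * pi * ?S y + \<theta>)) / 2) * sin (((2 * pi * ?S y + \<theta>) - (2 * pi * ?S x + \<theta>)) / 2)"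
        unfolding wave_def by (rule cos_diff_cos)
      also have "((2 * pi * ?S y + \<theta>) - (2 * pi * ?S x + \<theta>)) / 2 = - (pi * ?S (x - y))"
      proof -
        have "((2 * pi * b + \<theta>) - (2 * pi * a + \<theta>)) / 2 = - (pi * (a - b))" for a b :: real
          by (simp add: field_simps)
        then show ?thesis unfolding diff[symmetric] .
      qed
      finally have "\<bar>wave k \<theta> x - wave k \<theta> y\<bar> = 2 * \<bar>sin (((2 * pi * ?S x + \<theta>) + (2 * pi * ?S y + \<theta>)) / 2)\<bar> * \<bar>sin (pi * ?S (x - y))\<bar>"
        by (simp add: abs_mult)
      also have "\<dots> \<le> 2 * 1 * \<bar>sin (pi * ?S (x - y))\<bar>"
        by (intro mult_right_mono mult_left_mono) auto
      also have "pi * ?S (x - y) = (\<Sum>i\<in>UNIV. of_int (k i) * (pi * (x - y) $ i))"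
        by (simp add: sum_distrib_left mult_ac)
      also have "\<bar>sin \<dots>\<bar> \<le> (\<Sum>i\<in>UNIV. \<bar>sin (of_int (k i) * (pi * (x - y) $ i))\<bar>)"
        by (rule abs_sin_sum_le) simp
      also have "\<dots> \<le> (\<Sum>i\<in>UNIV. \<bar>of_int (k i)\<bar> * (sqrt CARD('n) * sqrt (gap (x - y))))"
        by (rule sum_mono, rule order_trans[OF abs_sin_of_int_mult_le], rule mult_left_mono, rule abs_sin_le_gap) simp
      finally have "\<bar>wave k \<theta> x - wave k \<theta> y\<bar> \<le> 2 * (\<Sum>i\<in>UNIV. \<bar>of_int (k i)\<bar> * (sqrt CARD('n) * sqrt (gap (x - y))))"
        by simp
      then have "\<bar>c\<bar> * \<bar>wave k \<theta> x - wave k \<theta> y\<bar> \<le> \<bar>c\<bar> * (2 * (\<Sum>i\<in>UNIV. \<bar>of_int (k i)\<bar> * (sqrt CARD('n) * sqrt (gap (x - y)))))"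
        by (rule mult_left_mono) simp
      then show ?thesis
        unfolding L_def abs_mult[symmetric] right_diff_distrib
        by (simp add: sum_distrib_right mult.assoc)
    qed
    then show ?case by blast
  next
    case (add f g)
    then obtain L M where "\<bar>f x - f y\<bar> \<le> L * sqrt (gap (x - y))" "\<bar>g x - g y\<bar> \<le> M * sqrt (gap (x - y))" for x y
      by blast
    then have "\<bar>(f x + g x) - (f y + g y)\<bar> \<le> (L + M) * sqrt (gap (x - y))" for x y
      using abs_triangle_ineq[of "f x - f y" "g x - g y"]
      by (smt (verit) distrib_right)
    then show ?case by blast
  qed
  then obtain L where L: "\<bar>f x - f y\<bar> \<le> L * sqrt (gap (x - y))" for x y by blast
  show ?thesis
  proof (rule that)
    show "\<bar>f x - f y\<bar> \<le> max 1 L * sqrt (gap (x - y))" for x y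
      by (rule order_trans[OF L]) (simp add: mult_right_mono gap_nonneg)
  qed simp
qed

lemma wave_diff:
  "wave k \<theta> (x - y) = wave k \<theta> x * wave k 0 y + wave k (\<theta> - pi / 2) x * wave k (- pi / 2) y"
proof -
  let ?S = "\<lambda>x. \<Sum>i\<in>UNIV. of_int (k i) * x $ i"
  have "2 * pi * ?S (x - y) + \<theta> = (2 * pi * ?S x + \<theta>) - 2 * pi * ?S y"
    by (simp add: right_diff_distrib sum_subtractf algebra_simps)
  moreover have "cos (t + (\<theta> - pi / 2)) = sin (t + \<theta>)" "cos (t + - pi / 2) = sin t" for t
    using cos_diff[of "t + \<theta>" "pi / 2"] cos_diff[of t "pi / 2"] by (simp_all add: add_diff_eq)
  ultimately show ?thesis
    unfolding wave_def by (simp only: cos_diff add_0_right)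
qed

lemma integrable_mult_trig:
  assumes "f \<in> trig" "integrable torus g"
  shows "integrable torus (\<lambda>x. g x * f x)"
proof -
  obtain B where "\<And>x. \<bar>f x\<bar> \<le> B" using trig_bounded[OF assms(1)] by blast
  then show ?thesis
    by (intro integrable_mult_bounded assms continuous_measurable_torus trig_continuous)
qed

text \<open>
  The addition theorem separates the variables: convolving with one frequency only reads off two
  Fourier coefficients.
\<close>

lemma convolution_wave:
  assumes "integrable torus f"
  shows "(LINT y|torus. f y * (c * wave k \<theta> (x - y)))
    = (c * (LINT y|torus. f y * wave k 0 y)) * wave k \<theta> x
      + (c * (LINT y|torus. f y * wave k (- pi / 2) y)) * wave k (\<theta> - pi / 2) x"
proof -
  have int: "integrable torus (\<lambda>y. f y * wave k \<phi> y)" for \<phi>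
    using integrable_mult_trig[OF trig.wave[of 1] assms] by simp
  have "(LINT y|torus. f y * (c * wave k \<theta> (x - y)))
     = (LINT y|torus. (c * wave k \<theta> x) * (f y * wave k 0 y) + (c * wave k (\<theta> - pi / 2) x) * (f y * wave k (- pi / 2) y))"
    by (simp add: wave_diff algebra_simps)
  also have "\<dots> = (c * wave k \<theta> x) * (LINT y|torus. f y * wave k 0 y) + (c * wave k (\<theta> - pi / 2) x) * (LINT y|torus. f y * wave k (- pi / 2) y)"
    using int by simp
  finally show ?thesis by (simp add: mult_ac)
qed

lemma trig_convolution_aux:
  assumes f: "integrable torus f" and K: "K \<in> trig"
  shows "(\<lambda>x. LINT y|torus. f y * K (x - y)) \<in> trig \<and>
    (\<forall>i. partial i (\<lambda>x. LINT y|torus. f y * K (x - y)) = (\<lambda>x. LINT y|torus. f y * partial i K (x - y)))"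
  using K
proof induction
  case (wave c k \<theta>)
  show ?case
    unfolding partial_wave convolution_wave[OF f]
    by (auto intro!: trig.intros simp: partial_add trig.wave partial_wave)
next
  case (add g h)
  have int: "integrable torus (\<lambda>y. f y * K (x - y))" if "K \<in> trig" for K x
    using integrable_mult_trig[OF trig_reflect_shift[OF that] f] .
  have "(\<lambda>x. LINT y|torus. f y * (K (x - y) + L (x - y))) = (\<lambda>x. (LINT y|torus. f y * K (x - y)) + (LINT y|torus. f y * L (x - y)))"
    if "K \<in> trig" "L \<in> trig" for K L
    using int that by (simp add: distrib_left)
  note split = this[OF add.hyps] this[OF trig_partial[OF add.hyps(1)] trig_partial[OF add.hyps(2)]]
  show ?case
  proof (intro conjI allI)
    show "(\<lambda>x. LINT y|torus. f y * (g (x - y) + h (x - y))) \<in> trig"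
      unfolding split by (rule trig.add) (use add.IH in blast)+
    show "partial i (\<lambda>x. LINT y|torus. f y * (g (x - y) + h (x - y)))
      = (\<lambda>x. LINT y|torus. f y * partial i (\<lambda>x. g x + h x) (x - y))" for i
      unfolding split partial_add[OF add.hyps]
      by (subst partial_add) (use add.IH in simp_all)
  qed
qed

lemma trig_convolution:
  "integrable torus f \<Longrightarrow> K \<in> trig \<Longrightarrow> (\<lambda>x. LINT y|torus. f y * K (x - y)) \<in> trig"
  using trig_convolution_aux by blast

lemma partial_convolution:
  "integrable torus f \<Longrightarrow> K \<in> trig \<Longrightarrow>
    partial i (\<lambda>x. LINT y|torus. f y * K (x - y)) = (\<lambda>x. LINT y|torus. f y * partial i K (x - y))"
  using trig_convolution_aux by blast

lemma trig_integrable: "f \<in> trig \<Longrightarrow> integrable torus f"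
  by (intro continuous_integrable_torus trig_continuous)

text \<open>
  Translating by half a wavelength changes the sign of the wave and preserves its integral.
\<close>

lemma integral_wave_eq_0:
  assumes "k i \<noteq> 0"
  shows "(LINT x|torus. wave k \<theta> x) = 0"
proof -
  have tr: "wave k \<theta> \<in> trig" using trig.wave[of 1] by simp
  have "wave k \<theta> (x + axis i (1 / (2 * of_int (k i)))) = - wave k \<theta> x" for x
  proof -
    have "(\<Sum>j\<in>UNIV. of_int (k j) * axis i (1 / (2 * of_int (k i))) $ j) = (1 / 2 :: real)"
      using assms by (simp add: axis_def if_distrib[of "\<lambda>f. _ * f"] sum.If_cases)
    then have "2 * pi * (\<Sum>j\<in>UNIV. of_int (k j) * (x + axis i (1 / (2 * of_int (k i)))) $ j) + \<theta>
      = (2 * pi * (\<Sum>j\<in>UNIV. of_int (k j) * x $ j) + \<theta>) + pi"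
      by (simp add: distrib_left sum.distrib)
    then show ?thesis unfolding wave_def by (simp only: cos_periodic_pi)
  qed
  then show ?thesis
    using integral_torus_shift[OF periodic_wave trig_continuous[OF tr], of "axis i (1 / (2 * of_int (k i)))"]
    by simp
qed

lemma integral_partial_trig: "f \<in> trig \<Longrightarrow> (LINT x|torus. partial i f x) = 0"
proof (induction rule: trig.induct)
  case (wave c k \<theta>)
  then show ?case
    unfolding partial_wave by (cases "k i = 0") (simp_all add: integral_wave_eq_0)
next
  case (add f g)
  then show ?case
    by (simp add: partial_add trig_integrable trig_partial)
qed

text \<open>
  Cosine polynomials with nonnegative coefficients are positive definite functions. Closure under
  products (by the product formula for cosines) makes powers of such a polynomial available as
  convolution kernels.
\<close>

inductive_set pos_trig :: "(real^'n \<Rightarrow> real) set" where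
  wave: "0 \<le> a \<Longrightarrow> (\<lambda>x. a * wave k 0 x) \<in> pos_trig"
| add: "f \<in> pos_trig \<Longrightarrow> g \<in> pos_trig \<Longrightarrow> (\<lambda>x. f x + g x) \<in> pos_trig"

lemma pos_trig_imp_trig: "f \<in> pos_trig \<Longrightarrow> f \<in> trig"
  by (induction rule: pos_trig.induct) (auto intro: trig.intros)

lemma pos_trig_even: "f \<in> pos_trig \<Longrightarrow> f (- x) = f x"
  by (induction rule: pos_trig.induct) (simp_all add: wave_def sum_negf)

lemma pos_trig_const: "0 \<le> a \<Longrightarrow> (\<lambda>x. a) \<in> pos_trig"
  using pos_trig.wave[of a "\<lambda>_. 0"] by (simp add: wave_def)

lemma pos_trig_mult_wave:
  assumes "0 \<le> a" "g \<in> pos_trig"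
  shows "(\<lambda>x. (a * wave k 0 x) * g x) \<in> pos_trig"
  using assms(2)
proof induction
  case (wave b l)
  have "(\<lambda>x. (a * wave k 0 x) * (b * wave l 0 x))
    = (\<lambda>x. (a * b / 2) * wave (\<lambda>i. k i - l i) 0 x + (a * b / 2) * wave (\<lambda>i. k i + l i) 0 x)"
    by (simp add: fun_eq_iff wave_def cos_times_cos sum_subtractf sum.distrib algebra_simps add_divide_distrib)
  then show ?case
    using pos_trig.add[OF pos_trig.wave pos_trig.wave, of "a * b / 2" "a * b / 2"] assms(1) wave by simp
next
  case (add g h)
  then show ?case using pos_trig.add by (simp add: distrib_left)
qed

lemma pos_trig_mult: "f \<in> pos_trig \<Longrightarrow> g \<in> pos_trig \<Longrightarrow> (\<lambda>x. f x * g x) \<in> pos_trig"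
proof (induction rule: pos_trig.induct)
  case (wave a k)
  then show ?case using pos_trig_mult_wave by blast
next
  case (add f h)
  then show ?case using pos_trig.add by (simp add: distrib_right)
qed

lemma pos_trig_power: "f \<in> pos_trig \<Longrightarrow> (\<lambda>x. f x ^ n) \<in> pos_trig"
  by (induction n) (auto intro: pos_trig_const pos_trig_mult)

lemma pos_trig_sum: "finite A \<Longrightarrow> (\<And>i. i \<in> A \<Longrightarrow> f i \<in> pos_trig) \<Longrightarrow> (\<lambda>x. \<Sum>i\<in>A. f i x) \<in> pos_trig"
  by (induction A rule: finite_induct) (auto intro: pos_trig_const pos_trig.add)

lemma partial_even_odd:
  assumes "K \<in> pos_trig"
  shows "partial i K (- x) = - partial i K x"
proof -
  have "(\<lambda>x. K (0 - x)) = K" using pos_trig_even[OF assms] by auto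
  then show ?thesis
    using partial_reflect_shift[OF pos_trig_imp_trig[OF assms], of i 0] by (metis diff_0 minus_minus)
qed

lemma trig_integrands_measurable:
  fixes \<phi> :: "real^'n \<Rightarrow> real"
  assumes "\<phi> \<in> trig"
  shows "partial i \<phi> \<in> borel_measurable torus" "laplacian \<phi> \<in> borel_measurable torus"
  using assms by (auto intro!: continuous_measurable_torus trig_continuous trig_partial trig_laplacian)

section \<open>Positive definite mollifiers\<close>

lemma one_minus_gap_pos_trig: "(\<lambda>x::real^'n. 1 - gap x) \<in> pos_trig"
proof -
  let ?k = "\<lambda>i j. if j = i then 1 else (0::int)"
  have w: "wave (?k i) 0 x = 1 - 2 * (sin (pi * x $ i))\<^sup>2" for i and x :: "real^'n"
    using cos_double_sin[of "pi * x $ i"]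
    by (simp add: wave_def if_distrib[of "\<lambda>f. f * _"] if_distrib[of of_int] sum.If_cases mult.assoc)
  have "1 - gap x = 1 / 2 + (\<Sum>i\<in>UNIV. 1 / (2 * CARD('n)) * wave (?k i) 0 x)" for x :: "real^'n"
    unfolding w gap_def
    by (simp add: right_diff_distrib sum_subtractf sum_distrib_left[symmetric] sum_divide_distrib[symmetric] field_simps)
  then have "(\<lambda>x::real^'n. 1 - gap x) = (\<lambda>x. 1 / 2 + (\<Sum>i\<in>UNIV. 1 / (2 * CARD('n)) * wave (?k i) 0 x))"
    by blast
  then show ?thesis
    by (simp only:) (intro pos_trig.add pos_trig_const pos_trig_sum pos_trig.wave; simp)
qed

lemma gap_continuous: "continuous_on UNIV (gap :: real^'n \<Rightarrow> real)"
  unfolding gap_def by (intro continuous_intros) auto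

text \<open>
  The normalising constants of the kernels. The type argument carries the dimension.
\<close>

definition mass :: "'n::finite itself \<Rightarrow> nat \<Rightarrow> real" where
  "mass _ m = (LINT x|torus. (1 - gap (x :: real^'n)) ^ m)"

lemma power_gap_trig: "(\<lambda>x::real^'n. (1 - gap x) ^ m) \<in> pos_trig"
  by (rule pos_trig_power[OF one_minus_gap_pos_trig])

lemma mass_le_1: "mass TYPE('n::finite) m \<le> 1"
proof -
  have "mass TYPE('n) m \<le> (LINT x|(torus :: (real^'n) measure). 1)"
    unfolding mass_def
    by (intro integral_mono trig_integrable[OF pos_trig_imp_trig[OF power_gap_trig]])
      (auto simp: power_le_one gap_nonneg gap_le_1)
  then show ?thesis by (simp add: measure_torus)
qed

text \<open>
  On a cube of side length of order 1/m the base of the power is at least 1 - 1/(2m), so the power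
  stays bounded below by Bernoulli's inequality. The optimal cube has side of order 1/sqrt m; any
  polynomial lower bound is good enough.
\<close>

lemma mass_lower_bound:
  assumes "0 < m"
  shows "(1 / 2) * (1 / (4 * real m)) ^ CARD('n) \<le> mass TYPE('n::finite) m"
proof -
  define r where "r = 1 / (8 * real m)"
  have r: "0 < r" "r \<le> 1 / 2" using assms unfolding r_def by (auto simp: field_simps)
  define B :: "(real^'n) set" where "B = cbox (\<chi> i. - r) (\<chi> i. r)"
  have sub: "B \<subseteq> cell"
  proof
    fix x assume "x \<in> B"
    then have "- r \<le> x $ i" "x $ i \<le> r" for i unfolding B_def by (auto simp: mem_box_cart)
    then have "\<bar>x $ i\<bar> \<le> 1 / 2" for i using r(2) by (smt (verit))
    then show "x \<in> cell" unfolding mem_cell by blast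
  qed
  have B: "B \<in> sets lebesgue" unfolding B_def by simp
  have "(\<chi> i. r) \<in> B" using r unfolding B_def by (simp add: mem_box_cart)
  then have ne: "cbox (\<chi> i. - r) (\<chi> i. r) \<noteq> ({} :: (real^'n) set)" unfolding B_def by blast
  have "measure lebesgue B = measure lborel B" unfolding B_def by simp
  also have "\<dots> = (\<Prod>i\<in>UNIV. ((\<chi> i. r) :: real^'n) $ i - ((\<chi> i. - r) :: real^'n) $ i)"
    unfolding B_def by (rule content_cbox_cart[OF ne])
  also have "\<dots> = (2 * r) ^ CARD('n)" by simp
  also have "2 * r = 1 / (4 * real m)" by (simp add: r_def)
  finally have meas: "measure torus B = (1 / (4 * real m)) ^ CARD('n)"
    using B sub by (simp add: torus_def measure_restrict_space)
  have Bt: "B \<in> sets torus"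
    unfolding torus_def using B sub by (auto simp: sets_restrict_space_iff)
  have low: "1 / 2 \<le> (1 - gap x) ^ m" if "x \<in> B" for x
  proof -
    have "(sin (pi * x $ i))\<^sup>2 \<le> (pi * r)\<^sup>2" for i
    proof -
      have "\<bar>sin (pi * x $ i)\<bar> \<le> \<bar>pi * x $ i\<bar>" by (rule abs_sin_x_le_abs_x)
      also have "\<dots> \<le> pi * r"
        using that unfolding B_def by (auto simp: mem_box_cart abs_mult abs_le_iff minus_le_iff)
      finally show ?thesis by (metis abs_ge_zero power2_abs power_mono)
    qed
    then have "(\<Sum>i\<in>(UNIV::'n set). (sin (pi * x $ i))\<^sup>2) \<le> (\<Sum>i\<in>(UNIV::'n set). (pi * r)\<^sup>2)"
      by (intro sum_mono)
    then have "gap x \<le> (pi * r)\<^sup>2"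
      unfolding gap_def by (simp add: field_simps)
    also have "\<dots> \<le> (4 * r)\<^sup>2"
      using pi_less_4 r by (intro power_mono mult_right_mono) auto
    also have "\<dots> = (1 / (2 * real m)) * (1 / (2 * real m))" by (simp add: r_def power2_eq_square)
    also have "\<dots> \<le> 1 * (1 / (2 * real m))"
      using assms by (intro mult_right_mono) auto
    finally have "real m * gap x \<le> 1 / 2"
      using assms by (simp add: field_simps)
    then show ?thesis
      using Bernoulli_inequality[of "- gap x" m] gap_le_1[of x] by simp
  qed
  have "(1 / 2) * (1 / (4 * real m)) ^ CARD('n) = (LINT x|torus. (1 / 2) * indicator B x)"
    using meas Bt by simp
  also have "\<dots> \<le> mass TYPE('n) m"
    unfolding mass_def
  proof (intro integral_mono trig_integrable[OF pos_trig_imp_trig[OF power_gap_trig]])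
    show "integrable torus (\<lambda>x. (1 / 2) * indicator B x :: real)"
      using Bt by (simp add: torus.emeasure_finite less_top[symmetric])
    show "(1 / 2) * indicator B x \<le> (1 - gap x) ^ m" for x
      using low[of x] gap_le_1[of x] by (auto simp: indicator_def)
  qed
  finally show ?thesis .
qed

lemma mass_pos: "0 < m \<Longrightarrow> 0 < mass TYPE('n::finite) m"
  using mass_lower_bound[of m, where 'n = 'n] by (smt (verit) zero_less_power zero_less_divide_iff of_nat_0_less_iff mult_pos_pos)

text \<open>
  If the mass dropped by more than a fixed factor A at each quadrupling of the exponent from some
  point on, it would decay faster than the polynomial lower bound allows once A exceeds
  4 to the power of the dimension.
\<close>

lemma mass_doubling:
  obtains A where "0 < A" "\<And>N. \<exists>m>N. mass TYPE('n::finite) m \<le> A * mass TYPE('n) (4 * m)"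
proof
  let ?J = "mass TYPE('n)" and ?A = "2 * 4 ^ CARD('n) :: real"
  show "0 < ?A" by simp
  fix N
  show "\<exists>m>N. ?J m \<le> ?A * ?J (4 * m)"
  proof (rule ccontr)
    assume "\<not> ?thesis"
    then have less: "?A * ?J (4 * m) < ?J m" if "m > N" for m
      using that by (auto simp: not_le)
    have decay: "?A ^ k * ?J (4 ^ k * Suc N) \<le> 1" for k
    proof (induction k)
      case 0
      then show ?case by (simp add: mass_le_1)
    next
      case (Suc k)
      have "N < 4 ^ k * Suc N"
        using mult_le_mono1[of 1 "4 ^ k" "Suc N"] by simp
      from less[OF this] have "?A ^ k * (?A * ?J (4 * (4 ^ k * Suc N))) \<le> ?A ^ k * ?J (4 ^ k * Suc N)"
        by (intro mult_left_mono) auto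
      also note Suc
      finally show ?case by (simp only: power_Suc mult_ac)
    qed
    obtain k :: nat where k: "2 * (4 * real (Suc N)) ^ CARD('n) < 2 ^ k"
      using real_arch_pow[of 2] by auto
    have "(1 / 2) * (1 / (4 * real (4 ^ k * Suc N))) ^ CARD('n) \<le> ?J (4 ^ k * Suc N)"
      by (rule mass_lower_bound) simp
    then have "?A ^ k * ((1 / 2) * (1 / (4 * real (4 ^ k * Suc N))) ^ CARD('n)) \<le> 1"
      by (rule order_trans[OF mult_left_mono decay[of k]]) simp
    moreover have "?A ^ k * ((1 / 2) * (1 / (4 * real (4 ^ k * Suc N))) ^ CARD('n))
      = 2 ^ k / (2 * (4 * real (Suc N)) ^ CARD('n))"
    proof -
      have "(4 ^ CARD('n)) ^ k = ((4 ^ k) ^ CARD('n) :: real)"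
        by (simp add: power_mult[symmetric] mult.commute)
      then have "?A ^ k = 2 ^ k * (4 ^ k) ^ CARD('n)" by (simp only: power_mult_distrib)
      moreover have "(1 / (4 * real (4 ^ k * Suc N))) ^ CARD('n)
          = 1 / ((4 ^ k) ^ CARD('n) * (4 * real (Suc N)) ^ CARD('n))"
      proof -
        have "4 * real (4 ^ k * Suc N) = 4 ^ k * (4 * real (Suc N))" by (simp add: algebra_simps)
        then show ?thesis by (simp only: power_one_over power_mult_distrib)
      qed
      ultimately show ?thesis by (simp only: mult_ac) simp
    qed
    ultimately have "2 ^ k \<le> 2 * (4 * real (Suc N)) ^ CARD('n)"
      by (simp add: divide_le_eq)
    with k show False by simp
  qed
qed

text \<open>
  Powers of 1 - t absorb factors m t; this turns each factor of the squared distance into a gain of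
  1/m at the price of one power of the kernel.
\<close>

lemma mult_power_one_minus_le:
  assumes "0 \<le> t" "t \<le> (1::real)"
  shows "real m * t * (1 - t) ^ m \<le> 1"
proof -
  have "real m * t * (1 - t) ^ m \<le> (1 + real m * t) * (1 - t) ^ m"
    using assms by (intro mult_right_mono) auto
  also have "\<dots> \<le> (1 + t) ^ m * (1 - t) ^ m"
    using assms by (intro mult_right_mono Bernoulli_inequality) auto
  also have "\<dots> = (1 - t\<^sup>2) ^ m"
    by (simp add: power_mult_distrib[symmetric] power2_eq_square algebra_simps)
  also have "\<dots> \<le> 1"
    using assms by (intro power_le_one) (auto simp: abs_square_le_1)
  finally show ?thesis .
qed

text \<open>
  Differentiating the power costs a factor N but also yields a factor comparable to the distance
  from the lattice, since the base attains its maximum there.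
\<close>

lemma abs_partial_power_gap_le:
  fixes x :: "real^'n"
  assumes "0 < N"
  shows "\<bar>partial i (\<lambda>x. c * (1 - gap x) ^ N) x\<bar> \<le> \<bar>c\<bar> * (N * (2 * pi)) * (sqrt (gap x) * (1 - gap x) ^ (N - 1))"
proof -
  have nth: "((\<lambda>x. x $ j) has_derivative (\<lambda>h. h $ j)) (at x)" for j and x :: "real^'n"
    by (rule bounded_linear_imp_has_derivative) (rule bounded_linear_vec_nth)
  let ?G = "\<lambda>h::real^'n. (\<Sum>j\<in>UNIV. (2 * pi * sin (pi * x $ j) * cos (pi * x $ j) / CARD('n)) * h $ j)"
  have G: "(gap has_derivative ?G) (at x)"
    unfolding gap_def
    by (rule derivative_eq_intros nth refl | simp)+
      (simp add: fun_eq_iff sum_divide_distrib mult_ac)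
  have "((\<lambda>x. c * (1 - gap x) ^ N) has_derivative
     (\<lambda>h. c * (of_nat N * (- ?G h) * (1 - gap x) ^ (N - 1)))) (at x)"
    by (rule derivative_eq_intros G refl | simp)+
  from partial_eqI[OF this]
  have "partial i (\<lambda>x. c * (1 - gap x) ^ N) x
    = c * (N * (- (2 * pi * sin (pi * x $ i) * cos (pi * x $ i) / CARD('n))) * (1 - gap x) ^ (N - 1))"
    by (simp only: sum_mult_axis)
  then have "\<bar>partial i (\<lambda>x. c * (1 - gap x) ^ N) x\<bar>
    = \<bar>c\<bar> * (N * (2 * pi)) * ((\<bar>sin (pi * x $ i)\<bar> * \<bar>cos (pi * x $ i)\<bar> / CARD('n)) * (1 - gap x) ^ (N - 1))"
    using gap_le_1[of x] by (simp add: abs_mult mult_ac)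
  also have "\<dots> \<le> \<bar>c\<bar> * (N * (2 * pi)) * (sqrt (gap x) * (1 - gap x) ^ (N - 1))"
  proof (intro mult_left_mono mult_right_mono)
    have "\<bar>sin (pi * x $ i)\<bar> * \<bar>cos (pi * x $ i)\<bar> \<le> (sqrt CARD('n) * sqrt (gap x)) * 1"
      by (intro mult_mono abs_sin_le_gap) (auto simp: gap_nonneg)
    also have "\<dots> \<le> (real CARD('n) * sqrt (gap x)) * 1"
    proof (intro mult_right_mono)
      have "1 \<le> real CARD('n)" by (simp add: Suc_leI)
      then show "sqrt (real CARD('n)) \<le> real CARD('n)"
        by (intro real_le_lsqrt) (auto simp: power2_eq_square)
    qed (auto simp: gap_nonneg)
    finally show "\<bar>sin (pi * x $ i)\<bar> * \<bar>cos (pi * x $ i)\<bar> / CARD('n) \<le> sqrt (gap x)"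
      by (simp add: divide_le_eq mult.commute)
  qed (use gap_le_1[of x] in auto)
  finally show ?thesis .
qed

text \<open>
  An approximate identity of positive definite trigonometric polynomials together with the moment
  bounds used below. The dominating kernels H are wider than K but still have integral one, so each
  bound is uniform in mean: the gradient times the distance stays bounded, while two additional factors
  of the distance produce a decay of order 1/n.
\<close>

locale mollifier =
  fixes K H :: "nat \<Rightarrow> real^'n \<Rightarrow> real" and C :: real
  assumes K_pos_trig: "K n \<in> pos_trig" and K_nonneg: "0 \<le> K n x" and K_mass: "(LINT x|torus. K n x) = 1"
    and H_trig: "H n \<in> trig" and H_mass: "(LINT x|torus. H n x) = 1"
    and C_pos: "0 < C"
    and K_gap: "gap x * K n x \<le> C / Suc n * H n x"
    and partial_K_gap: "sqrt (gap x) * \<bar>partial i (K n) x\<bar> \<le> C * H n x"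
    and partial_K_gap3: "sqrt (gap x) ^ 3 * \<bar>partial i (K n) x\<bar> \<le> C / Suc n * H n x"

text \<open>
  Take K to be the normalised power of 1 - gap with exponent 4m and H the one with exponent m. Of the
  four m-th powers in K, differentiation spoils at most one, at most two absorb factors of gap, one
  becomes H, and what is left is bounded by one. Replacing the normalisation of K by that of H costs a constant factor exactly when
  the mass is doubling at m, hence the choice of the exponents.
\<close>

lemma mollifier_exists: "\<exists>(K :: nat \<Rightarrow> real^'n \<Rightarrow> real) H C. mollifier K H C"
proof -
  let ?J = "mass TYPE('n)" and ?p = "\<lambda>x::real^'n. 1 - gap x"
  obtain A where A: "0 < A" "\<And>N. \<exists>m>N. ?J m \<le> A * ?J (4 * m)"
    using mass_doubling by blast
  then obtain s where s: "\<And>n. n < s n" "\<And>n. ?J (s n) \<le> A * ?J (4 * s n)" by metis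
  define K where "K n x = 1 / ?J (4 * s n) * ?p x ^ (4 * s n)" for n x
  define H where "H n x = 1 / ?J (s n) * ?p x ^ s n" for n x
  have s0: "0 < s n" for n using s(1)[of n] by simp
  have J: "0 < ?J (s n)" "0 < ?J (4 * s n)" for n using s0[of n] by (auto intro!: mass_pos)
  have p: "0 \<le> ?p x" "?p x \<le> 1" for x using gap_le_1[of x] gap_nonneg[of x] by auto
  have ratio: "1 / ?J (4 * s n) \<le> A * (1 / ?J (s n))" for n
    using s(2)[of n] J[of n] by (simp add: field_simps)
  \<comment> \<open>The last remaining power turns into H when the two normalisations are exchanged.\<close>
  have absorb: "1 / ?J (4 * s n) * (y * ?p x ^ s n) \<le> y * (A * H n x)" if "0 \<le> y" for n x y
  proof -
    have "1 / ?J (4 * s n) * (y * ?p x ^ s n) \<le> A * (1 / ?J (s n)) * (y * ?p x ^ s n)"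
      using that p by (intro mult_right_mono ratio) auto
    then show ?thesis by (simp add: H_def mult_ac)
  qed
  have one: "s n * gap x * ?p x ^ s n \<le> 1" for n x
    by (rule mult_power_one_minus_le[OF gap_nonneg gap_le_1])
  have inv: "1 / s n \<le> 1 / Suc n" for n
    using s(1)[of n] by (intro divide_left_mono) auto
  have Hn: "0 \<le> H n x" for n x unfolding H_def using J[of n] p[of x] by simp
  have powers: "?p x ^ N \<le> ?p x ^ M" if "M \<le> N" for M N x
    using p[of x] that by (intro power_decreasing) auto
  have gapK: "gap x * K n x \<le> A / s n * H n x" for n x
  proof -
    have "gap x * K n x \<le> 1 / ?J (4 * s n) * (1 / s n * (s n * gap x * ?p x ^ s n) * ?p x ^ s n)"
    proof -
      have "?p x ^ (4 * s n) \<le> ?p x ^ s n * ?p x ^ s n"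
        unfolding power_add[symmetric] by (rule powers) simp
      then have "1 / ?J (4 * s n) * gap x * ?p x ^ (4 * s n) \<le> 1 / ?J (4 * s n) * gap x * (?p x ^ s n * ?p x ^ s n)"
        using J(2)[of n] gap_nonneg[of x] by (intro mult_left_mono) auto
      then show ?thesis using s0[of n] by (simp add: K_def mult_ac)
    qed
    also have "\<dots> \<le> 1 / s n * (s n * gap x * ?p x ^ s n) * (A * H n x)"
      using p[of x] gap_nonneg[of x] by (intro absorb) auto
    also have "\<dots> \<le> 1 / s n * 1 * (A * H n x)"
      using A(1) Hn[of n x] by (intro mult_right_mono mult_left_mono one) auto
    finally show ?thesis by simp
  qed
  \<comment> \<open>The exponent left after differentiation is one less than 4m and hence still at least 3m.\<close>
  have dK: "sqrt (gap x) * \<bar>partial i (K n) x\<bar> \<le> 8 * pi * (s n * gap x * ?p x ^ s n) * (1 / ?J (4 * s n) * (?p x ^ s n * ?p x ^ s n))" for i n x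
  proof -
    have "\<bar>partial i (K n) x\<bar> \<le> \<bar>1 / ?J (4 * s n)\<bar> * (real (4 * s n) * (2 * pi)) * (sqrt (gap x) * ?p x ^ (4 * s n - 1))"
      unfolding K_def[abs_def] by (rule abs_partial_power_gap_le) (use s0 in simp)
    then have "\<bar>partial i (K n) x\<bar> \<le> 1 / ?J (4 * s n) * (real (4 * s n) * (2 * pi)) * (sqrt (gap x) * ?p x ^ (4 * s n - 1))"
      using J(2)[of n] by simp
    also have "\<dots> \<le> 1 / ?J (4 * s n) * (real (4 * s n) * (2 * pi)) * (sqrt (gap x) * (?p x ^ s n * ?p x ^ s n * ?p x ^ s n))"
      unfolding power_add[symmetric] using J(2)[of n] gap_nonneg[of x] s0[of n]
      by (intro mult_left_mono powers) auto
    finally have "sqrt (gap x) * \<bar>partial i (K n) x\<bar> \<le> sqrt (gap x) * (1 / ?J (4 * s n) * (real (4 * s n) * (2 * pi)) * (sqrt (gap x) * (?p x ^ s n * ?p x ^ s n * ?p x ^ s n)))"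
      using gap_nonneg[of x] by (intro mult_left_mono) auto
    also have "\<dots> = 8 * pi * (s n * (sqrt (gap x) * sqrt (gap x)) * ?p x ^ s n) * (1 / ?J (4 * s n) * (?p x ^ s n * ?p x ^ s n))"
      by (simp add: mult_ac)
    also have "sqrt (gap x) * sqrt (gap x) = gap x" using gap_nonneg[of x] by simp
    finally show ?thesis .
  qed
  have dK1: "sqrt (gap x) * \<bar>partial i (K n) x\<bar> \<le> 8 * pi * (A * H n x)" for i n x
  proof -
    note dK[of x i n]
    also have "8 * pi * (s n * gap x * ?p x ^ s n) * (1 / ?J (4 * s n) * (?p x ^ s n * ?p x ^ s n))
       \<le> 8 * pi * 1 * (?p x ^ s n * (A * H n x))"
      using p[of x] J(2)[of n] by (intro mult_mono mult_left_mono one absorb) auto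
    also have "\<dots> \<le> 8 * pi * 1 * (1 * (A * H n x))"
      using p[of x] A(1) Hn[of n x] by (intro mult_left_mono mult_right_mono power_le_one) auto
    finally show ?thesis by simp
  qed
  have dK3: "sqrt (gap x) ^ 3 * \<bar>partial i (K n) x\<bar> \<le> 8 * pi * (A / s n * H n x)" for i n x
  proof -
    have "sqrt (gap x) ^ 3 * \<bar>partial i (K n) x\<bar> = gap x * (sqrt (gap x) * \<bar>partial i (K n) x\<bar>)"
      using gap_nonneg[of x] by (simp add: power3_eq_cube)
    also have "\<dots> \<le> gap x * (8 * pi * (s n * gap x * ?p x ^ s n) * (1 / ?J (4 * s n) * (?p x ^ s n * ?p x ^ s n)))"
      by (intro mult_left_mono dK gap_nonneg)
    also have "\<dots> = 8 * pi * (s n * gap x * ?p x ^ s n) * (1 / ?J (4 * s n) * ((1 / s n * (s n * gap x * ?p x ^ s n)) * ?p x ^ s n))"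
      using s0[of n] by (simp add: mult_ac)
    also have "\<dots> \<le> 8 * pi * 1 * (1 / s n * (s n * gap x * ?p x ^ s n) * (A * H n x))"
      using p[of x] J(2)[of n] gap_nonneg[of x] by (intro mult_mono mult_left_mono one absorb) auto
    also have "\<dots> \<le> 8 * pi * 1 * (1 / s n * 1 * (A * H n x))"
      using p[of x] A(1) Hn[of n x] by (intro mult_left_mono mult_right_mono one) auto
    finally show ?thesis by simp
  qed
  define C where "C = A + 8 * pi * A"
  have C: "A \<le> C" "8 * pi * A \<le> C" "0 < C" unfolding C_def using A(1) by (auto intro: add_pos_pos)
  have final: "c / s n * H n x \<le> C / Suc n * H n x" if "c \<le> C" for c n x
  proof (rule mult_right_mono[OF _ Hn])
    have "c / s n \<le> C * (1 / s n)" using that s0[of n] by (simp add: divide_right_mono)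
    also have "\<dots> \<le> C * (1 / Suc n)" using C(3) by (intro mult_left_mono inv) auto
    finally show "c / s n \<le> C / Suc n" by simp
  qed
  have "mollifier K H C"
  proof
    fix n x i
    show "K n \<in> pos_trig"
      unfolding K_def[abs_def] using J(2)[of n]
      by (intro pos_trig_mult pos_trig_const power_gap_trig) simp
    show "0 \<le> K n x" unfolding K_def using J(2)[of n] p[of x] by simp
    show "(LINT x|torus. K n x) = 1"
      unfolding K_def using J(2)[of n] by (simp add: mass_def)
    show "H n \<in> trig"
      unfolding H_def[abs_def] by (intro trig_cmult pos_trig_imp_trig power_gap_trig)
    show "(LINT x|torus. H n x) = 1"
      unfolding H_def using J(1)[of n] by (simp add: mass_def)
    show "0 < C" by (rule C)
    show "gap x * K n x \<le> C / Suc n * H n x"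
      using gapK final[OF C(1)] by (rule order_trans)
    show "sqrt (gap x) * \<bar>partial i (K n) x\<bar> \<le> C * H n x"
      using dK1[of x i n] mult_right_mono[OF C(2) Hn[of n x]] by (simp add: mult_ac)
    show "sqrt (gap x) ^ 3 * \<bar>partial i (K n) x\<bar> \<le> C / Suc n * H n x"
      using dK3[of x i n] final[OF C(2), of n x] by (simp add: mult_ac)
  qed
  then show ?thesis by blast
qed

section \<open>Mollification in the mean\<close>

text \<open>
  A measurable function is an almost everywhere limit of continuous functions. Truncating the
  function and then the approximants at the same level makes dominated convergence applicable.
\<close>

lemma L1_approx_continuous:
  fixes f :: "real^'n \<Rightarrow> real"
  assumes f: "integrable torus f" and e: "0 < e"
  obtains g B where "continuous_on UNIV g" "\<And>x. \<bar>g x\<bar> \<le> B" "(LINT x|torus. \<bar>f x - g x\<bar>) < e"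
proof -
  have [measurable]: "f \<in> borel_measurable torus" using f by simp
  have "f measurable_on cell"
    by (subst measurable_on_iff_borel_measurable) (use f in \<open>auto simp: torus_def\<close>)
  then obtain N G where N: "negligible N" and G: "\<And>n. continuous_on UNIV (G n)"
    and lim: "\<And>x. x \<notin> N \<Longrightarrow> (\<lambda>n. G n x) \<longlonglongrightarrow> (if x \<in> cell then f x else 0)"
    unfolding measurable_on_def by blast
  have "AE x in lebesgue. x \<notin> N"
    using N by (simp add: AE_not_in negligible_iff_null_sets)
  then have "AE x in torus. x \<notin> N"
    unfolding torus_def by (subst AE_restrict_space_iff) auto
  then have limAE: "AE x in torus. (\<lambda>n. G n x) \<longlonglongrightarrow> f x"
    using AE_space
  proof eventually_elim
    case (elim x)
    then show ?case using lim[of x] by (simp add: space_torus)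
  qed
  define clamp :: "real \<Rightarrow> real \<Rightarrow> real" where "clamp m t = max (- m) (min m t)" for m t
  have cont: "continuous_on UNIV (\<lambda>x. clamp m (G n x))" for m n
    unfolding clamp_def by (intro continuous_intros G)
  have [measurable]: "(\<lambda>x. clamp m (f x)) \<in> borel_measurable torus" for m
    unfolding clamp_def by measurable
  have [measurable]: "(\<lambda>x. clamp m (G n x)) \<in> borel_measurable torus" for m n
    by (rule continuous_measurable_torus[OF cont])
  have clamp_le: "\<bar>clamp (real m) t\<bar> \<le> real m" for m t unfolding clamp_def by auto
  have "(\<lambda>m. LINT x|torus. \<bar>f x - clamp (real m) (f x)\<bar>) \<longlonglongrightarrow> (LINT x|(torus :: (real^'n) measure). 0)"
  proof (rule integral_dominated_convergence[where w = "\<lambda>x. \<bar>f x\<bar>"])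
    show "integrable torus (\<lambda>x. \<bar>f x\<bar>)" using f by simp
    have "(\<lambda>m. \<bar>f x - clamp (real m) (f x)\<bar>) \<longlonglongrightarrow> 0" for x
    proof (rule tendsto_eventually)
      have "\<forall>\<^sub>F m in sequentially. \<bar>f x\<bar> \<le> real m"
        by (meson eventually_at_top_linorder order_trans real_arch_simple of_nat_mono)
      then show "\<forall>\<^sub>F m in sequentially. \<bar>f x - clamp (real m) (f x)\<bar> = 0"
        by eventually_elim (auto simp: clamp_def)
    qed
    then show "AE x in torus. (\<lambda>m. \<bar>f x - clamp (real m) (f x)\<bar>) \<longlonglongrightarrow> 0" by simp
    show "AE x in torus. norm \<bar>f x - clamp (real m) (f x)\<bar> \<le> \<bar>f x\<bar>" for m
      by (intro AE_I2) (auto simp: clamp_def)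
  qed measurable
  then have "\<forall>\<^sub>F m in sequentially. (LINT x|torus. \<bar>f x - clamp (real m) (f x)\<bar>) < e / 2"
    using e by (intro order_tendstoD) auto
  then obtain m where m: "(LINT x|torus. \<bar>f x - clamp (real m) (f x)\<bar>) < e / 2"
    by (meson eventually_happens trivial_limit_sequentially)
  have int_clamp: "integrable torus (\<lambda>x. clamp (real m) (f x))" "integrable torus (\<lambda>x. clamp (real m) (G n x))" for n
    by (rule torus.integrable_const_bound[where B = "real m"], use clamp_le in \<open>auto\<close>)+
  have "(\<lambda>n. LINT x|torus. \<bar>clamp (real m) (f x) - clamp (real m) (G n x)\<bar>) \<longlonglongrightarrow> (LINT x|(torus :: (real^'n) measure). 0)"
  proof (rule integral_dominated_convergence[where w = "\<lambda>x. 2 * real m"])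
    show "AE x in torus. (\<lambda>n. \<bar>clamp (real m) (f x) - clamp (real m) (G n x)\<bar>) \<longlonglongrightarrow> 0"
      using limAE
    proof eventually_elim
      case (elim x)
      have "(\<lambda>n. \<bar>clamp (real m) (f x) - clamp (real m) (G n x)\<bar>) \<longlonglongrightarrow> \<bar>clamp (real m) (f x) - clamp (real m) (f x)\<bar>"
        unfolding clamp_def by (intro tendsto_intros elim)
      then show ?case by simp
    qed
    show "AE x in torus. norm \<bar>clamp (real m) (f x) - clamp (real m) (G n x)\<bar> \<le> 2 * real m" for n
      by (intro AE_I2) (auto simp: clamp_def)
  qed auto
  then have "\<forall>\<^sub>F n in sequentially. (LINT x|torus. \<bar>clamp (real m) (f x) - clamp (real m) (G n x)\<bar>) < e / 2"
    using e by (intro order_tendstoD) auto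
  then obtain n where n: "(LINT x|torus. \<bar>clamp (real m) (f x) - clamp (real m) (G n x)\<bar>) < e / 2"
    by (meson eventually_happens trivial_limit_sequentially)
  show ?thesis
  proof
    show "continuous_on UNIV (\<lambda>x. clamp (real m) (G n x))" by (rule cont)
    show "\<bar>clamp (real m) (G n x)\<bar> \<le> real m" for x by (rule clamp_le)
    have "(LINT x|torus. \<bar>f x - clamp (real m) (G n x)\<bar>)
      \<le> (LINT x|torus. \<bar>f x - clamp (real m) (f x)\<bar> + \<bar>clamp (real m) (f x) - clamp (real m) (G n x)\<bar>)"
      using f int_clamp by (intro integral_mono) auto
    also have "\<dots> = (LINT x|torus. \<bar>f x - clamp (real m) (f x)\<bar>) + (LINT x|torus. \<bar>clamp (real m) (f x) - clamp (real m) (G n x)\<bar>)"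
      using f int_clamp by simp
    also have "\<dots> < e" using m n by simp
    finally show "(LINT x|torus. \<bar>f x - clamp (real m) (G n x)\<bar>) < e" .
  qed
qed

lemma integral_trig_diff_snd: "h \<in> trig \<Longrightarrow> (LINT y|torus. h (x - y)) = (LINT y|torus. h y)"
  by (rule integral_torus_reflect[OF trig_periodic trig_continuous])

lemma integral_trig_diff_fst: "h \<in> trig \<Longrightarrow> (LINT x|torus. h (x - y)) = (LINT x|torus. h x)"
  using integral_torus_shift[OF trig_periodic trig_continuous, of h "- y"] by simp

text \<open>
  Distinct points of the closed cell can represent the same point of the torus, but not if one of them
  is interior.
\<close>

lemma gap_eq_0_imp_eq:
  assumes "gap (x - y) = 0" "\<And>i. \<bar>x $ i\<bar> < 1 / 2" "\<And>i. \<bar>y $ i\<bar> \<le> 1 / 2"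
  shows "x = y"
proof -
  have "x $ i = y $ i" for i
  proof -
    have "sin (pi * (x $ i - y $ i)) = 0"
      using abs_sin_le_gap[of "x - y" i] assms(1) by simp
    then obtain m where "pi * (x $ i - y $ i) = of_int m * pi"
      unfolding sin_zero_iff_int2 by blast
    then have m: "x $ i - y $ i = of_int m" by simp
    moreover have "\<bar>x $ i - y $ i\<bar> < 1" using assms(2,3)[of i] by linarith
    ultimately have "m = 0" by linarith
    then show ?thesis using m by simp
  qed
  then show ?thesis by (simp add: vec_eq_iff)
qed

text \<open>
  The function need not be periodic, so points that are close only across a face of the cell say
  nothing about each other. Away from the interior point x the gap has a positive minimum over the
  closed cell by compactness, and there a large multiple of it dominates the bounded difference.
\<close>

lemma continuous_gap_modulus:
  fixes g :: "real^'n \<Rightarrow> real"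
  assumes g: "continuous_on UNIV g" "\<And>x. \<bar>g x\<bar> \<le> B"
    and x: "\<And>i. \<bar>x $ i\<bar> < 1 / 2" and e: "0 < e"
  obtains L where "0 \<le> L" "\<And>y. y \<in> cell \<Longrightarrow> \<bar>g y - g x\<bar> \<le> e + L * gap (x - y)"
proof -
  obtain \<delta> where \<delta>: "0 < \<delta>" "\<And>y. dist y x < \<delta> \<Longrightarrow> \<bar>g y - g x\<bar> < e"
    using g(1) e unfolding continuous_on_iff dist_real_def by (metis UNIV_I)
  define S where "S = cell - ball x \<delta>"
  have S: "compact S" unfolding S_def by (intro compact_diff compact_cbox open_ball)
  have cont: "continuous_on S (\<lambda>y. gap (x - y))"
    by (rule continuous_on_compose2[OF gap_continuous]) (auto intro!: continuous_intros)
  have "\<exists>\<kappa>>0. \<forall>y\<in>S. \<kappa> \<le> gap (x - y)"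
  proof (cases "S = {}")
    case False
    from continuous_attains_inf[OF S False cont]
    obtain z where z: "z \<in> S" "\<And>y. y \<in> S \<Longrightarrow> gap (x - z) \<le> gap (x - y)" by blast
    have "gap (x - z) \<noteq> 0"
    proof
      assume "gap (x - z) = 0"
      then have "x = z"
        by (rule gap_eq_0_imp_eq[OF _ x]) (use z(1) mem_cell[of z] in \<open>auto simp: S_def\<close>)
      then show False using z(1) \<delta>(1) by (simp add: S_def)
    qed
    then have "0 < gap (x - z)" using gap_nonneg[of "x - z"] by simp
    then show ?thesis using z by blast
  qed (use zero_less_one in blast)
  then obtain \<kappa> where \<kappa>: "0 < \<kappa>" "\<And>y. y \<in> S \<Longrightarrow> \<kappa> \<le> gap (x - y)" by blast
  have B: "0 \<le> B" using g(2)[of 0] by linarith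
  show ?thesis
  proof
    show "0 \<le> 2 * B / \<kappa>" using \<kappa>(1) B by simp
    fix y :: "real^'n" assume y: "y \<in> cell"
    show "\<bar>g y - g x\<bar> \<le> e + 2 * B / \<kappa> * gap (x - y)"
    proof (cases "y \<in> S")
      case True
      have "\<bar>g y - g x\<bar> \<le> 2 * B" using g(2)[of x] g(2)[of y] by linarith
      also have "\<dots> = 2 * B / \<kappa> * \<kappa>" using \<kappa>(1) by simp
      also have "\<dots> \<le> 2 * B / \<kappa> * gap (x - y)"
        using \<kappa> B True by (intro mult_left_mono) auto
      finally show ?thesis using e by simp
    next
      case False
      then have "dist y x < \<delta>" using y by (auto simp: S_def dist_commute)
      then have "\<bar>g y - g x\<bar> < e" by (rule \<delta>)
      moreover have "0 \<le> 2 * B / \<kappa> * gap (x - y)"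
        using \<kappa>(1) B by (intro mult_nonneg_nonneg divide_nonneg_pos gap_nonneg) auto
      ultimately show ?thesis by linarith
    qed
  qed
qed

lemma AE_torus_interior: "AE x in torus. \<forall>i. \<bar>(x :: real^'n) $ i\<bar> < 1 / 2"
proof -
  let ?a = "(\<chi> i. - 1/2) :: real^'n" and ?b = "(\<chi> i. 1/2) :: real^'n"
  have "AE x in lebesgue. x \<notin> cbox ?a ?b - box ?a ?b"
    using negligible_frontier_interval by (intro AE_not_in) (simp add: negligible_iff_null_sets)
  then have "AE x in torus. x \<notin> cbox ?a ?b - box ?a ?b"
    unfolding torus_def by (subst AE_restrict_space_iff) auto
  then show ?thesis
    using AE_space
  proof eventually_elim
    case (elim x)
    then have "x \<in> box ?a ?b" by (simp add: space_torus)
    then have "- 1 / 2 < x $ i" "x $ i < 1 / 2" for i by (simp_all add: mem_box_cart)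
    then have "\<bar>x $ i\<bar> < 1 / 2" for i unfolding abs_less_iff by (simp add: minus_less_iff)
    then show ?case by blast
  qed
qed

context mollifier
begin

lemma K_trig: "K n \<in> trig"
  by (rule pos_trig_imp_trig[OF K_pos_trig])

definition mollify :: "nat \<Rightarrow> (real^'n \<Rightarrow> real) \<Rightarrow> real^'n \<Rightarrow> real" where
  "mollify n f x = (LINT y|torus. f y * K n (x - y))"

lemma mollify_trig: "integrable torus f \<Longrightarrow> mollify n f \<in> trig"
  unfolding mollify_def[abs_def] by (rule trig_convolution[OF _ K_trig])

lemma mollify_integrand: "integrable torus f \<Longrightarrow> integrable torus (\<lambda>y. f y * K n (x - y))"
  by (rule integrable_mult_trig[OF trig_reflect_shift[OF K_trig]])

lemma K_integrable: "integrable torus (\<lambda>y. K n (x - y))"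
  by (rule trig_integrable[OF trig_reflect_shift[OF K_trig]])

lemma H_integrable: "integrable torus (\<lambda>y. H n (x - y))"
  by (rule trig_integrable[OF trig_reflect_shift[OF H_trig]])

lemma K_mass_diff: "(LINT y|torus. K n (x - y)) = 1" "(LINT x|torus. K n (x - y)) = 1"
  by (simp_all only: integral_trig_diff_snd[OF K_trig] integral_trig_diff_fst[OF K_trig] K_mass)

lemma H_mass_diff: "(LINT y|torus. H n (x - y)) = 1" "(LINT x|torus. H n (x - y)) = 1"
  by (simp_all only: integral_trig_diff_snd[OF H_trig] integral_trig_diff_fst[OF H_trig] H_mass)

lemma mollify_diff:
  "integrable torus f \<Longrightarrow> integrable torus g \<Longrightarrow> mollify n (\<lambda>x. f x - g x) x = mollify n f x - mollify n g x"
  unfolding mollify_def by (simp add: left_diff_distrib mollify_integrand)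

lemma mollify_bounded:
  assumes "integrable torus f" "\<And>x. \<bar>f x\<bar> \<le> B"
  shows "\<bar>mollify n f x\<bar> \<le> B"
proof -
  have "\<bar>mollify n f x\<bar> \<le> (LINT y|torus. \<bar>f y * K n (x - y)\<bar>)"
    unfolding mollify_def by (rule integral_abs_bound)
  also have "\<dots> \<le> (LINT y|torus. B * K n (x - y))"
    using assms K_nonneg K_integrable
    by (intro integral_mono integrable_abs mollify_integrand) (auto simp: abs_mult intro!: mult_right_mono)
  also have "\<dots> = B" by (simp add: K_mass_diff)
  finally show ?thesis .
qed

lemma mollify_L1_contraction:
  assumes f: "integrable torus f"
  shows "(LINT x|torus. \<bar>mollify n f x\<bar>) \<le> (LINT x|torus. \<bar>f x\<bar>)"
proof -
  obtain B where B: "\<And>x. \<bar>K n x\<bar> \<le> B" using trig_bounded[OF K_trig] by blast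
  have fa: "integrable torus (\<lambda>x. \<bar>f x\<bar>)" using f by simp
  have one: "integrable torus (\<lambda>x::real^'n. 1 :: real)" by simp
  have "(LINT x|torus. \<bar>mollify n f x\<bar>) \<le> (LINT x|torus. mollify n (\<lambda>y. \<bar>f y\<bar>) x)"
  proof (intro integral_mono)
    show "\<bar>mollify n f x\<bar> \<le> mollify n (\<lambda>y. \<bar>f y\<bar>) x" for x
      unfolding mollify_def using integral_abs_bound[of torus "\<lambda>y. f y * K n (x - y)"]
      by (simp add: abs_mult K_nonneg)
  qed (simp_all add: f trig_integrable[OF mollify_trig])
  also have "\<dots> = (LINT y|torus. \<bar>f y\<bar> * (LINT x|torus. K n (x - y)))"
    using convolution_fst[OF one fa trig_continuous[OF K_trig] B]
      convolution_snd[OF one fa trig_continuous[OF K_trig] B]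
    unfolding mollify_def by simp
  finally show ?thesis by (simp add: K_mass_diff)
qed

lemma mollify_tendsto_pointwise:
  assumes g: "continuous_on UNIV g" "\<And>x. \<bar>g x\<bar> \<le> B" and x: "\<And>i. \<bar>x $ i\<bar> < 1 / 2"
  shows "(\<lambda>n. mollify n g x) \<longlonglongrightarrow> g x"
proof (rule LIMSEQ_I)
  fix e :: real assume e: "0 < e"
  then have "0 < e / 2" by simp
  from continuous_gap_modulus[OF g x this]
  obtain L where L: "0 \<le> L" "\<And>y. y \<in> cell \<Longrightarrow> \<bar>g y - g x\<bar> \<le> e / 2 + L * gap (x - y)" by blast
  have int: "integrable torus g" by (rule continuous_integrable_torus[OF g(1)])
  have bound: "\<bar>mollify n g x - g x\<bar> \<le> e / 2 + L * C / Suc n" for n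
  proof -
    have "mollify n g x - g x = (LINT y|torus. (g y - g x) * K n (x - y))"
      unfolding mollify_def using mollify_integrand[OF int] K_integrable
      by (simp add: left_diff_distrib K_mass_diff)
    then have "\<bar>mollify n g x - g x\<bar> \<le> (LINT y|torus. \<bar>(g y - g x) * K n (x - y)\<bar>)"
      using integral_abs_bound by metis
    also have "\<dots> \<le> (LINT y|torus. e / 2 * K n (x - y) + L * C / Suc n * H n (x - y))"
    proof (rule integral_mono)
      show "integrable torus (\<lambda>y. \<bar>(g y - g x) * K n (x - y)\<bar>)"
        using int by (intro integrable_abs mollify_integrand) simp
      show "integrable torus (\<lambda>y. e / 2 * K n (x - y) + L * C / Suc n * H n (x - y))"
        using K_integrable H_integrable by simp
      fix y :: "real^'n" assume "y \<in> space torus"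
      then have "\<bar>(g y - g x) * K n (x - y)\<bar> \<le> (e / 2 + L * gap (x - y)) * K n (x - y)"
        using L(2)[of y] K_nonneg by (auto simp: abs_mult space_torus intro!: mult_right_mono)
      also have "\<dots> = e / 2 * K n (x - y) + L * (gap (x - y) * K n (x - y))"
        by (simp add: algebra_simps)
      also have "\<dots> \<le> e / 2 * K n (x - y) + L * (C / Suc n * H n (x - y))"
        using L(1) by (intro add_left_mono mult_left_mono K_gap)
      finally show "\<bar>(g y - g x) * K n (x - y)\<bar> \<le> e / 2 * K n (x - y) + L * C / Suc n * H n (x - y)"
        by simp
    qed
    also have "\<dots> = e / 2 + L * C / Suc n"
      using K_integrable H_integrable by (simp add: K_mass_diff H_mass_diff)
    finally show ?thesis .
  qed
  have "(\<lambda>n. L * C / Suc n) \<longlonglongrightarrow> 0"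
    using LIMSEQ_Suc[OF lim_const_over_n[of "L * C"]] by simp
  then have "\<forall>\<^sub>F n in sequentially. L * C / Suc n < e / 2"
    using e by (intro order_tendstoD) auto
  then obtain N where N: "\<And>n. n \<ge> N \<Longrightarrow> L * C / Suc n < e / 2"
    by (auto simp: eventually_sequentially)
  have "norm (mollify n g x - g x) < e" if "n \<ge> N" for n
    using bound[of n] N[OF that] unfolding real_norm_def by linarith
  then show "\<exists>no. \<forall>n\<ge>no. norm (mollify n g x - g x) < e" by blast
qed

lemma mollify_tendsto_continuous:
  assumes g: "continuous_on UNIV g" "\<And>x. \<bar>g x\<bar> \<le> B"
  shows "(\<lambda>n. LINT x|torus. \<bar>mollify n g x - g x\<bar>) \<longlonglongrightarrow> 0"
proof -
  have int: "integrable torus g" by (rule continuous_integrable_torus[OF g(1)])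
  have "(\<lambda>n. LINT x|torus. \<bar>mollify n g x - g x\<bar>) \<longlonglongrightarrow> (LINT x|(torus :: (real^'n) measure). 0)"
  proof (rule integral_dominated_convergence[where w = "\<lambda>x. 2 * B"])
    have "(\<lambda>n. \<bar>mollify n g x - g x\<bar>) \<longlonglongrightarrow> 0" if x: "\<forall>i. \<bar>x $ i\<bar> < 1 / 2" for x
    proof -
      have "(\<lambda>n. \<bar>mollify n g x - g x\<bar>) \<longlonglongrightarrow> \<bar>g x - g x\<bar>"
        by (intro tendsto_rabs tendsto_diff tendsto_const mollify_tendsto_pointwise[OF g]) (use x in blast)
      then show ?thesis by simp
    qed
    with AE_torus_interior show "AE x in torus. (\<lambda>n. \<bar>mollify n g x - g x\<bar>) \<longlonglongrightarrow> 0"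
      by (auto elim: eventually_mono)
    show "(\<lambda>x. \<bar>mollify n g x - g x\<bar>) \<in> borel_measurable torus" for n
      using trig_integrable[OF mollify_trig[OF int]] int by auto
    show "AE x in torus. norm \<bar>mollify n g x - g x\<bar> \<le> 2 * B" for n
      using mollify_bounded[OF int g(2), of n] g(2)
      by (intro AE_I2) (smt (verit) real_norm_def)
  qed auto
  then show ?thesis by simp
qed

text \<open>
  Mollification contracts the mean norm, so it is enough to treat a dense class; for bounded
  continuous functions the convergence holds pointwise in the open cell, by the modulus above.
\<close>

lemma mollify_tendsto_L1:
  assumes f: "integrable torus f"
  shows "(\<lambda>n. LINT x|torus. \<bar>mollify n f x - f x\<bar>) \<longlonglongrightarrow> 0"
proof (rule LIMSEQ_I)
  fix e :: real assume e: "0 < e"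
  then have "0 < e / 3" by simp
  from L1_approx_continuous[OF f this] obtain g B where g: "continuous_on UNIV g" "\<And>x. \<bar>g x\<bar> \<le> B"
    and fg: "(LINT x|torus. \<bar>f x - g x\<bar>) < e / 3" by blast
  have int: "integrable torus g" by (rule continuous_integrable_torus[OF g(1)])
  note mint = trig_integrable[OF mollify_trig]
  have bound: "(LINT x|torus. \<bar>mollify n f x - f x\<bar>)
    \<le> 2 * (LINT x|torus. \<bar>f x - g x\<bar>) + (LINT x|torus. \<bar>mollify n g x - g x\<bar>)" for n
  proof -
    have "(LINT x|torus. \<bar>mollify n f x - f x\<bar>) \<le> (LINT x|torus. \<bar>mollify n (\<lambda>x. f x - g x) x\<bar> + \<bar>mollify n g x - g x\<bar> + \<bar>f x - g x\<bar>)"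
    proof (rule integral_mono)
      show "\<bar>mollify n f x - f x\<bar> \<le> \<bar>mollify n (\<lambda>x. f x - g x) x\<bar> + \<bar>mollify n g x - g x\<bar> + \<bar>f x - g x\<bar>" for x
        unfolding mollify_diff[OF f int] by linarith
    qed (use f int mint in auto)
    also have "\<dots> = (LINT x|torus. \<bar>mollify n (\<lambda>x. f x - g x) x\<bar>) + (LINT x|torus. \<bar>mollify n g x - g x\<bar>) + (LINT x|torus. \<bar>f x - g x\<bar>)"
      using f int mint by simp
    also have "(LINT x|torus. \<bar>mollify n (\<lambda>x. f x - g x) x\<bar>) \<le> (LINT x|torus. \<bar>f x - g x\<bar>)"
      using f int by (intro mollify_L1_contraction) simp
    finally show ?thesis by simp
  qed
  have "\<forall>\<^sub>F n in sequentially. (LINT x|torus. \<bar>mollify n g x - g x\<bar>) < e / 3"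
    using mollify_tendsto_continuous[OF g] e by (intro order_tendstoD) auto
  then obtain N where N: "\<And>n. n \<ge> N \<Longrightarrow> (LINT x|torus. \<bar>mollify n g x - g x\<bar>) < e / 3"
    by (auto simp: eventually_sequentially)
  have "norm ((LINT x|torus. \<bar>mollify n f x - f x\<bar>) - 0) < e" if "n \<ge> N" for n
    using bound[of n] N[OF that] fg by simp
  then show "\<exists>no. \<forall>n\<ge>no. norm ((LINT x|torus. \<bar>mollify n f x - f x\<bar>) - 0) < e" by blast
qed

end

section \<open>The commutator estimate\<close>

text \<open>
  Jordan's inequality, from concavity of the sine on the first quarter period.
\<close>

lemma sin_pi_ge:
  assumes "\<bar>t\<bar> \<le> 1 / 2"
  shows "2 * \<bar>t\<bar> \<le> \<bar>sin (pi * t)\<bar>"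
proof -
  have "convex_on {0..pi / 2} (\<lambda>x. - sin x)"
    by (rule f''_ge0_imp_convex[where f' = "\<lambda>x. - cos x" and f'' = sin])
      (auto intro!: derivative_eq_intros sin_ge_zero)
  from convex_onD_Icc[OF this, of "2 * \<bar>t\<bar>"] assms
  have "2 * \<bar>t\<bar> \<le> sin (pi * \<bar>t\<bar>)"
    by (simp add: mult.commute)
  also have "\<dots> \<le> \<bar>sin (pi * t)\<bar>"
    by (cases "t \<ge> 0") auto
  finally show ?thesis .
qed

lemma abs_coord_le_gap:
  fixes z :: "real^'n"
  assumes "z \<in> cell"
  shows "\<bar>z $ j\<bar> \<le> sqrt CARD('n) / 2 * sqrt (gap z)"
  using sin_pi_ge[of "z $ j"] abs_sin_le_gap[of z j] assms unfolding mem_cell by force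

lemma gap_le_norm: "sqrt (gap (w :: real^'n)) \<le> pi * norm w"
proof -
  have "gap w * 1 \<le> gap w * real CARD('n)"
    using gap_nonneg[of w] by (intro mult_left_mono) (auto simp: Suc_leI)
  also have "\<dots> = (\<Sum>i\<in>UNIV. (sin (pi * w $ i))\<^sup>2)"
    by (simp add: gap_def)
  also have "\<dots> \<le> (\<Sum>i\<in>UNIV. (pi * w $ i)\<^sup>2)"
    by (intro sum_mono) (metis abs_sin_x_le_abs_x abs_le_square_iff)
  also have "\<dots> = (pi * norm w)\<^sup>2"
    by (simp add: power_mult_distrib sum_distrib_left[symmetric] norm_vec_def L2_set_def sum_nonneg)
  finally show ?thesis
    by (intro real_le_lsqrt) (simp_all add: gap_nonneg)
qed

lemma trig_directional_derivative:
  assumes f: "f \<in> trig"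
  shows "(\<lambda>m. real (Suc m) * (f (y + (1 / real (Suc m)) *\<^sub>R z) - f y)) \<longlonglongrightarrow> (\<Sum>j\<in>UNIV. partial j f y * z $ j)"
proof -
  let ?D = "\<Sum>j\<in>UNIV. partial j f y * z $ j"
  have "((\<lambda>t. f (y + t *\<^sub>R z)) has_derivative (\<lambda>t. \<Sum>j\<in>UNIV. partial j f (y + 0 *\<^sub>R z) * (t *\<^sub>R z) $ j)) (at 0)"
    by (rule has_derivative_compose[OF _ trig_has_derivative[OF f], of "\<lambda>t. y + t *\<^sub>R z" "\<lambda>t. t *\<^sub>R z" 0 UNIV])
      (auto intro!: derivative_eq_intros)
  moreover have "(\<lambda>t. \<Sum>j\<in>UNIV. partial j f (y + 0 *\<^sub>R z) * (t *\<^sub>R z) $ j) = (*) ?D"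
    by (simp add: fun_eq_iff sum_distrib_left mult_ac)
  ultimately have "((\<lambda>t. f (y + t *\<^sub>R z)) has_field_derivative ?D) (at 0)"
    by (simp add: has_field_derivative_def)
  then have lim: "((\<lambda>t. (f (y + t *\<^sub>R z) - f y) / t) \<longlongrightarrow> ?D) (at 0)"
    by (simp add: DERIV_def)
  have "filterlim (\<lambda>m. 1 / real (Suc m)) (at 0) sequentially"
    unfolding filterlim_at using LIMSEQ_Suc[OF lim_const_over_n[of 1]] by simp
  from filterlim_compose[OF lim this] show ?thesis
    by (simp add: mult.commute)
qed

text \<open>
  Split the translation into m equal steps. By translation invariance all steps contribute the same
  amount, so the left side is bounded by the mean of the difference quotient with step 1/m, which tends
  to the mean of the directional derivative.
\<close>

lemma trig_translation_L1:
  fixes z :: "real^'n"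
  assumes f: "f \<in> trig"
  shows "(LINT y|torus. \<bar>f (y + z) - f y\<bar>) \<le> (\<Sum>j\<in>UNIV. \<bar>z $ j\<bar> * (LINT y|torus. \<bar>partial j f y\<bar>))"
proof -
  let ?h = "\<lambda>m y. real (Suc m) * (f (y + (1 / real (Suc m)) *\<^sub>R z) - f y)"
  have tr: "(\<lambda>y. f (y + v) - f y) \<in> trig" for v
    by (intro trig_diff trig_shift f)
  have htr: "?h m \<in> trig" for m
    by (intro trig_cmult tr)
  have step: "(LINT y|torus. \<bar>f (y + z) - f y\<bar>) \<le> (LINT y|torus. \<bar>?h m y\<bar>)" for m
  proof -
    define w where "w = (1 / real (Suc m)) *\<^sub>R z"
    have tel: "f (y + z) - f y = (\<Sum>k<Suc m. f ((y + real k *\<^sub>R w) + w) - f (y + real k *\<^sub>R w))" for y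
    proof -
      have "(\<Sum>k<Suc m. f ((y + real k *\<^sub>R w) + w) - f (y + real k *\<^sub>R w))
        = (\<Sum>k<Suc m. f (y + real (Suc k) *\<^sub>R w) - f (y + real k *\<^sub>R w))"
        by (intro sum.cong refl arg_cong2[where f = "(-)"] arg_cong[where f = f]) (simp add: algebra_simps)
      also have "\<dots> = f (y + real (Suc m) *\<^sub>R w) - f (y + real 0 *\<^sub>R w)"
        by (rule sum_lessThan_telescope)
      finally show ?thesis by (simp add: w_def)
    qed
    have shifted: "(\<lambda>y. f ((y + real k *\<^sub>R w) + w) - f (y + real k *\<^sub>R w)) \<in> trig" for k
      using trig_shift[OF tr[of w], of "real k *\<^sub>R w"] .
    have "(LINT y|torus. \<bar>f (y + z) - f y\<bar>)
      \<le> (LINT y|torus. (\<Sum>k<Suc m. \<bar>f ((y + real k *\<^sub>R w) + w) - f (y + real k *\<^sub>R w)\<bar>))"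
    proof (rule integral_mono)
      show "integrable torus (\<lambda>y. \<bar>f (y + z) - f y\<bar>)"
        by (intro integrable_abs trig_integrable tr)
      show "integrable torus (\<lambda>y. \<Sum>k<Suc m. \<bar>f ((y + real k *\<^sub>R w) + w) - f (y + real k *\<^sub>R w)\<bar>)"
        by (intro Bochner_Integration.integrable_sum integrable_abs trig_integrable shifted)
      show "\<bar>f (y + z) - f y\<bar> \<le> (\<Sum>k<Suc m. \<bar>f ((y + real k *\<^sub>R w) + w) - f (y + real k *\<^sub>R w)\<bar>)" for y
        unfolding tel by (rule sum_abs)
    qed
    also have "\<dots> = (\<Sum>k<Suc m. (LINT y|torus. \<bar>f ((y + real k *\<^sub>R w) + w) - f (y + real k *\<^sub>R w)\<bar>))"
      using shifted by (intro Bochner_Integration.integral_sum integrable_abs trig_integrable)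
    also have "\<dots> = (\<Sum>k<Suc m. (LINT y|torus. \<bar>f (y + w) - f y\<bar>))"
    proof (intro sum.cong refl)
      fix k
      have "periodic (\<lambda>y. \<bar>f (y + w) - f y\<bar>)"
        using trig_periodic[OF tr[of w]] by (simp add: periodic_def)
      moreover have "continuous_on UNIV (\<lambda>y. \<bar>f (y + w) - f y\<bar>)"
        by (intro continuous_on_rabs trig_continuous tr)
      ultimately show "(LINT y|torus. \<bar>f ((y + real k *\<^sub>R w) + w) - f (y + real k *\<^sub>R w)\<bar>) = (LINT y|torus. \<bar>f (y + w) - f y\<bar>)"
        by (rule integral_torus_shift)
    qed
    also have "\<dots> = real (Suc m) * (LINT y|torus. \<bar>f (y + w) - f y\<bar>)" by simp
    also have "\<dots> = (LINT y|torus. \<bar>?h m y\<bar>)"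
      unfolding w_def[symmetric] by (simp add: abs_mult)
    finally show ?thesis .
  qed
  obtain L where L: "0 < L" "\<And>x y. \<bar>f x - f y\<bar> \<le> L * sqrt (gap (x - y))"
    using trig_gap_lipschitz[OF f] by blast
  have "(\<lambda>m. LINT y|torus. \<bar>?h m y\<bar>) \<longlonglongrightarrow> (LINT y|torus. \<bar>\<Sum>j\<in>UNIV. partial j f y * z $ j\<bar>)"
  proof (rule integral_dominated_convergence[where w = "\<lambda>_. L * (pi * norm z)"])
    show "AE y in torus. (\<lambda>m. \<bar>?h m y\<bar>) \<longlonglongrightarrow> \<bar>\<Sum>j\<in>UNIV. partial j f y * z $ j\<bar>"
      by (intro AE_I2 tendsto_rabs trig_directional_derivative f)
    show "AE y in torus. norm \<bar>?h m y\<bar> \<le> L * (pi * norm z)" for m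
    proof (rule AE_I2)
      fix y
      have "\<bar>f (y + (1 / real (Suc m)) *\<^sub>R z) - f y\<bar> \<le> L * (pi * norm ((1 / real (Suc m)) *\<^sub>R z))"
        using L(2)[of "y + (1 / real (Suc m)) *\<^sub>R z" y] L(1) gap_le_norm[of "(1 / real (Suc m)) *\<^sub>R z"]
        by (smt (verit) add_diff_cancel_left' mult_left_mono)
      then have "real (Suc m) * \<bar>f (y + (1 / real (Suc m)) *\<^sub>R z) - f y\<bar> \<le> real (Suc m) * (L * (pi * norm ((1 / real (Suc m)) *\<^sub>R z)))"
        by (intro mult_left_mono) auto
      then show "norm \<bar>?h m y\<bar> \<le> L * (pi * norm z)"
        by (simp add: abs_mult)
    qed
    show "(\<lambda>y. \<bar>?h m y\<bar>) \<in> borel_measurable torus" for m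
      by (intro borel_measurable_abs continuous_measurable_torus trig_continuous htr)
    show "(\<lambda>y. \<bar>\<Sum>j\<in>UNIV. partial j f y * z $ j\<bar>) \<in> borel_measurable torus"
      by (intro borel_measurable_abs borel_measurable_sum borel_measurable_times continuous_measurable_torus
          trig_continuous trig_partial f borel_measurable_const)
  qed simp
  then have "(LINT y|torus. \<bar>f (y + z) - f y\<bar>) \<le> (LINT y|torus. \<bar>\<Sum>j\<in>UNIV. partial j f y * z $ j\<bar>)"
    by (rule LIMSEQ_le_const) (use step in blast)
  also have "\<dots> \<le> (LINT y|torus. (\<Sum>j\<in>UNIV. \<bar>z $ j\<bar> * \<bar>partial j f y\<bar>))"
  proof (intro integral_mono)
    show "integrable torus (\<lambda>y. \<bar>\<Sum>j\<in>UNIV. partial j f y * z $ j\<bar>)"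
      by (intro integrable_abs Bochner_Integration.integrable_sum integrable_mult_left trig_integrable trig_partial f)
    show "integrable torus (\<lambda>y. \<Sum>j\<in>UNIV. \<bar>z $ j\<bar> * \<bar>partial j f y\<bar>)"
      by (intro integrable_abs Bochner_Integration.integrable_sum integrable_mult_right trig_integrable trig_partial f)
    show "\<bar>\<Sum>j\<in>UNIV. partial j f y * z $ j\<bar> \<le> (\<Sum>j\<in>UNIV. \<bar>z $ j\<bar> * \<bar>partial j f y\<bar>)" for y
      using sum_abs[of "\<lambda>j. partial j f y * z $ j" UNIV] by (simp add: abs_mult mult.commute)
  qed
  also have "\<dots> = (\<Sum>j\<in>UNIV. \<bar>z $ j\<bar> * (LINT y|torus. \<bar>partial j f y\<bar>))"
  proof -
    have "integrable torus (\<lambda>y. \<bar>z $ j\<bar> * \<bar>partial j f y\<bar>)" for j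
      by (intro integrable_mult_right integrable_abs trig_integrable trig_partial f)
    then have "(LINT y|torus. (\<Sum>j\<in>UNIV. \<bar>z $ j\<bar> * \<bar>partial j f y\<bar>)) = (\<Sum>j\<in>UNIV. LINT y|torus. \<bar>z $ j\<bar> * \<bar>partial j f y\<bar>)"
      by (rule Bochner_Integration.integral_sum)
    then show ?thesis by simp
  qed
  finally show ?thesis .
qed

lemma integrable_difference_mult_trig:
  fixes f h :: "real^'n \<Rightarrow> real"
  assumes f: "integrable torus f" and h: "h \<in> trig"
  shows "integrable (torus \<Otimes>\<^sub>M torus) (\<lambda>(x, y). \<bar>f x - f y\<bar> * \<bar>h (x - y)\<bar>)"
proof -
  obtain B where B: "\<And>x. \<bar>h x\<bar> \<le> B" using trig_bounded[OF h] by blast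
  have "integrable (torus \<Otimes>\<^sub>M torus) (\<lambda>p. \<bar>f (fst p) - f (snd p)\<bar>)"
    using integrable_torus2_fst[OF f] integrable_torus2_snd[OF f]
    by (intro integrable_abs Bochner_Integration.integrable_diff) (simp_all add: case_prod_beta')
  from integrable_mult_bounded[OF this, of "\<lambda>p. \<bar>h (fst p - snd p)\<bar>" B]
  show ?thesis
    using B diff_measurable_torus2[OF trig_continuous[OF h]] by (simp add: case_prod_beta')
qed

context mollifier
begin

text \<open>
  Substituting x = z + y for fixed y, the inner mean is that of a translation difference, which is at
  most the coordinates of z times the mean of the gradient; the coordinates of z are in turn absorbed by
  the gradient of the kernel. The constant does not depend on n, which is the point.
\<close>

lemma trig_commutator_le:
  assumes f: "f \<in> trig"
  shows "(\<integral>(x, y). \<bar>f x - f y\<bar> * \<bar>partial i (K n) (x - y)\<bar> \<partial>(torus \<Otimes>\<^sub>M torus))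
    \<le> sqrt CARD('n) / 2 * C * (\<Sum>j\<in>UNIV. LINT y|torus. \<bar>partial j f y\<bar>)"
proof -
  let ?dK = "partial i (K n)" and ?S = "\<Sum>j\<in>UNIV. LINT y|torus. \<bar>partial j f y\<bar>"
  have dK: "?dK \<in> trig" by (rule trig_partial[OF K_trig])
  obtain B where B: "0 < B" "\<And>x. \<bar>f x\<bar> \<le> B" using trig_bounded[OF f] by blast
  obtain B' where B': "0 < B'" "\<And>x. \<bar>?dK x\<bar> \<le> B'" using trig_bounded[OF dK] by blast
  have [measurable]: "f \<in> borel_measurable borel" "?dK \<in> borel_measurable borel"
    by (intro borel_measurable_continuous_onI trig_continuous f dK)+
  have int: "integrable (torus \<Otimes>\<^sub>M torus) (\<lambda>(z, y). \<bar>f (z + y) - f y\<bar> * \<bar>?dK z\<bar>)"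
  proof (rule torus2.integrable_const_bound[where B = "2 * B * B'"])
    have "\<bar>f (z + y) - f y\<bar> * \<bar>?dK z\<bar> \<le> 2 * B * B'" for z y
    proof (rule mult_mono[OF _ B'(2)])
      show "\<bar>f (z + y) - f y\<bar> \<le> 2 * B" using B(2)[of "z + y"] B(2)[of y] by linarith
    qed (use B(1) in auto)
    then show "AE p in torus \<Otimes>\<^sub>M torus. norm (case p of (z, y) \<Rightarrow> \<bar>f (z + y) - f y\<bar> * \<bar>?dK z\<bar>) \<le> 2 * B * B'"
      by (intro AE_I2) (auto simp: abs_mult)
  qed measurable
  have "(\<integral>(x, y). \<bar>f x - f y\<bar> * \<bar>?dK (x - y)\<bar> \<partial>(torus \<Otimes>\<^sub>M torus))
    = (LINT y|torus. LINT x|torus. \<bar>f x - f y\<bar> * \<bar>?dK (x - y)\<bar>)"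
    using torus2.integral_snd[OF integrable_difference_mult_trig[OF trig_integrable[OF f] dK]] by simp
  also have "\<dots> = (LINT y|torus. LINT z|torus. \<bar>f (z + y) - f y\<bar> * \<bar>?dK z\<bar>)"
  proof (rule Bochner_Integration.integral_cong[OF refl])
    fix y
    have "periodic (\<lambda>x. \<bar>f x - f y\<bar> * \<bar>?dK (x - y)\<bar>)"
      using trig_periodic[OF f] trig_periodic[OF trig_shift[OF dK, of "- y"]] by (simp add: periodic_def)
    moreover have "continuous_on UNIV (\<lambda>x. \<bar>f x - f y\<bar> * \<bar>?dK (x - y)\<bar>)"
      using trig_continuous[OF f] trig_continuous[OF trig_shift[OF dK, of "- y"]]
      by (auto intro!: continuous_intros)
    ultimately have "(LINT z|torus. \<bar>f (z + y) - f y\<bar> * \<bar>?dK ((z + y) - y)\<bar>) = (LINT x|torus. \<bar>f x - f y\<bar> * \<bar>?dK (x - y)\<bar>)"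
      by (rule integral_torus_shift)
    then show "(LINT x|torus. \<bar>f x - f y\<bar> * \<bar>?dK (x - y)\<bar>) = (LINT z|torus. \<bar>f (z + y) - f y\<bar> * \<bar>?dK z\<bar>)"
      by simp
  qed
  also have "\<dots> = (LINT z|torus. LINT y|torus. \<bar>f (z + y) - f y\<bar> * \<bar>?dK z\<bar>)"
    by (rule torus2.Fubini_integral[OF int])
  also have "\<dots> \<le> (LINT z|torus. sqrt CARD('n) / 2 * C * ?S * H n z)"
  proof (rule integral_mono)
    show "integrable torus (\<lambda>z. LINT y|torus. \<bar>f (z + y) - f y\<bar> * \<bar>?dK z\<bar>)"
      using torus2.integrable_fst[OF int] .
    show "integrable torus (\<lambda>z. sqrt CARD('n) / 2 * C * ?S * H n z)"
      by (intro integrable_mult_right trig_integrable H_trig)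
    fix z :: "real^'n" assume "z \<in> space torus"
    then have z: "z \<in> cell" by (simp add: space_torus)
    have D: "0 \<le> (LINT y|torus. \<bar>partial j f y\<bar>)" for j by simp
    have "(LINT y|torus. \<bar>f (z + y) - f y\<bar> * \<bar>?dK z\<bar>) = (LINT y|torus. \<bar>f (y + z) - f y\<bar>) * \<bar>?dK z\<bar>"
      by (simp add: add.commute)
    also have "\<dots> \<le> (\<Sum>j\<in>UNIV. \<bar>z $ j\<bar> * (LINT y|torus. \<bar>partial j f y\<bar>)) * \<bar>?dK z\<bar>"
      by (intro mult_right_mono trig_translation_L1 f) simp
    also have "\<dots> \<le> (\<Sum>j\<in>UNIV. (sqrt CARD('n) / 2 * sqrt (gap z)) * (LINT y|torus. \<bar>partial j f y\<bar>)) * \<bar>?dK z\<bar>"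
      by (rule mult_right_mono, rule sum_mono, rule mult_right_mono, rule abs_coord_le_gap[OF z]) simp_all
    also have "\<dots> = sqrt CARD('n) / 2 * ?S * (sqrt (gap z) * \<bar>?dK z\<bar>)"
      by (subst sum_distrib_left[symmetric]) (simp add: mult_ac)
    also have "\<dots> \<le> sqrt CARD('n) / 2 * ?S * (C * H n z)"
      by (intro mult_left_mono partial_K_gap mult_nonneg_nonneg sum_nonneg D) auto
    finally show "(LINT y|torus. \<bar>f (z + y) - f y\<bar> * \<bar>?dK z\<bar>) \<le> sqrt CARD('n) / 2 * C * ?S * H n z"
      by (simp add: mult_ac)
  qed
  also have "\<dots> = sqrt CARD('n) / 2 * C * ?S"
    by (simp add: H_mass)
  finally show ?thesis .
qed

text \<open>
  The reflected and translated kernel is the test function in the definition of the weak derivative.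
\<close>

lemma partial_mollify:
  assumes f: "integrable torus f" and weak: "weak_partial j f g"
  shows "partial j (mollify n f) = mollify n g"
proof (rule ext)
  fix x
  let ?\<phi> = "\<lambda>y. K n (x - y)"
  have "?\<phi> \<in> C_infinity" by (intro trig_C_infinity trig_reflect_shift K_trig)
  then have "(LINT y|torus. partial j ?\<phi> y *\<^sub>R f y) = - (LINT y|torus. ?\<phi> y *\<^sub>R g y)"
    using weak unfolding weak_partial_def by blast
  then have "(LINT y|torus. f y * partial j (K n) (x - y)) = (LINT y|torus. g y * K n (x - y))"
    unfolding partial_reflect_shift[OF K_trig] by (simp add: mult.commute)
  then show "partial j (mollify n f) x = mollify n g x"
    unfolding mollify_def[abs_def] partial_convolution[OF f K_trig] .
qed

text \<open>
  The remainder of the mollification is approximated by trigonometric polynomials, namely by the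
  differences of two mollifications. For fixed n the kernel gradient is bounded, so convergence in
  mean suffices for the left side, while on the right the gradients of the mollifications are the
  mollifications of the weak gradient.
\<close>

lemma W11_commutator_le:
  assumes f: "integrable torus f" and G: "\<And>j. integrable torus (G j)" and weak: "\<And>j. weak_partial j f (G j)"
  shows "(\<integral>(x, y). \<bar>(f x - mollify m f x) - (f y - mollify m f y)\<bar> * \<bar>partial i (K n) (x - y)\<bar> \<partial>(torus \<Otimes>\<^sub>M torus))
    \<le> sqrt CARD('n) / 2 * C * (\<Sum>j\<in>UNIV. LINT y|torus. \<bar>mollify m (G j) y - G j y\<bar>)" (is "?lhs \<le> ?A * ?S m")
proof -
  let ?dK = "partial i (K n)"
  have dK: "?dK \<in> trig" by (rule trig_partial[OF K_trig])
  obtain B where B: "0 < B" "\<And>x. \<bar>?dK x\<bar> \<le> B" using trig_bounded[OF dK] by blast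
  let ?X = "\<lambda>p. ?A * (?S p + ?S m) + B * (2 * (LINT x|torus. \<bar>mollify p f x - f x\<bar>))"
  have "(\<lambda>p. ?X p) \<longlonglongrightarrow> ?A * ((\<Sum>j\<in>(UNIV :: 'n set). 0) + ?S m) + B * (2 * 0)"
    by (intro tendsto_intros mollify_tendsto_L1 f G)
  then have lim: "?X \<longlonglongrightarrow> ?A * ?S m" by simp
  have "?lhs \<le> ?X p" for p
  proof -
    let ?r = "\<lambda>x. f x - mollify m f x" and ?rp = "\<lambda>x. mollify p f x - mollify m f x" and ?s = "\<lambda>x. mollify p f x - f x"
    note mint = trig_integrable[OF mollify_trig]
    have rp: "?rp \<in> trig" by (intro trig_diff mollify_trig f)
    have r: "integrable torus ?r" using f mint by simp
    have s: "integrable torus (\<lambda>x. \<bar>?s x\<bar>)" using f mint by simp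
    have int: "integrable (torus \<Otimes>\<^sub>M torus) (\<lambda>z. \<bar>?rp (fst z) - ?rp (snd z)\<bar> * \<bar>?dK (fst z - snd z)\<bar>)"
      "integrable (torus \<Otimes>\<^sub>M (torus :: (real^'n) measure)) (\<lambda>z. \<bar>?s (fst z)\<bar>)"
      "integrable ((torus :: (real^'n) measure) \<Otimes>\<^sub>M torus) (\<lambda>z. \<bar>?s (snd z)\<bar>)"
      using integrable_difference_mult_trig[OF trig_integrable[OF rp] dK]
        integrable_torus2_fst[OF s] integrable_torus2_snd[OF s] by (simp_all add: case_prod_beta')
    have "?lhs \<le> (\<integral>z. \<bar>?rp (fst z) - ?rp (snd z)\<bar> * \<bar>?dK (fst z - snd z)\<bar> + B * (\<bar>?s (fst z)\<bar> + \<bar>?s (snd z)\<bar>) \<partial>(torus \<Otimes>\<^sub>M torus))"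
    proof (rule integral_mono[OF integrable_difference_mult_trig[OF r dK]])
      show "integrable (torus \<Otimes>\<^sub>M torus) (\<lambda>z. \<bar>?rp (fst z) - ?rp (snd z)\<bar> * \<bar>?dK (fst z - snd z)\<bar> + B * (\<bar>?s (fst z)\<bar> + \<bar>?s (snd z)\<bar>))"
        using int by simp
      fix z :: "(real^'n) \<times> (real^'n)"
      obtain x y where z: "z = (x, y)" by force
      have "\<bar>?r x - ?r y\<bar> * \<bar>?dK (x - y)\<bar> \<le> (\<bar>?rp x - ?rp y\<bar> + (\<bar>?s x\<bar> + \<bar>?s y\<bar>)) * \<bar>?dK (x - y)\<bar>"
        by (intro mult_right_mono) auto
      also have "\<dots> = \<bar>?rp x - ?rp y\<bar> * \<bar>?dK (x - y)\<bar> + (\<bar>?s x\<bar> + \<bar>?s y\<bar>) * \<bar>?dK (x - y)\<bar>"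
        by (rule distrib_right)
      also have "(\<bar>?s x\<bar> + \<bar>?s y\<bar>) * \<bar>?dK (x - y)\<bar> \<le> (\<bar>?s x\<bar> + \<bar>?s y\<bar>) * B"
        using B(2) by (intro mult_left_mono) auto
      finally show "(case z of (x, y) \<Rightarrow> \<bar>?r x - ?r y\<bar> * \<bar>?dK (x - y)\<bar>)
        \<le> \<bar>?rp (fst z) - ?rp (snd z)\<bar> * \<bar>?dK (fst z - snd z)\<bar> + B * (\<bar>?s (fst z)\<bar> + \<bar>?s (snd z)\<bar>)"
        by (simp add: z mult.commute)
    qed
    also have "\<dots> = (\<integral>(x, y). \<bar>?rp x - ?rp y\<bar> * \<bar>?dK (x - y)\<bar> \<partial>(torus \<Otimes>\<^sub>M torus))
       + B * ((\<integral>(x, y). \<bar>?s x\<bar> \<partial>(torus \<Otimes>\<^sub>M (torus :: (real^'n) measure))) + (\<integral>(x, y). \<bar>?s y\<bar> \<partial>((torus :: (real^'n) measure) \<Otimes>\<^sub>M torus)))"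
      using int by (simp add: case_prod_beta')
    also have "\<dots> = (\<integral>(x, y). \<bar>?rp x - ?rp y\<bar> * \<bar>?dK (x - y)\<bar> \<partial>(torus \<Otimes>\<^sub>M torus)) + B * (2 * (LINT x|torus. \<bar>?s x\<bar>))"
      unfolding integral_torus2_fst[OF s] integral_torus2_snd[OF s] by simp
    also have "(\<integral>(x, y). \<bar>?rp x - ?rp y\<bar> * \<bar>?dK (x - y)\<bar> \<partial>(torus \<Otimes>\<^sub>M torus)) \<le> ?A * (\<Sum>j\<in>UNIV. LINT y|torus. \<bar>partial j ?rp y\<bar>)"
      by (rule trig_commutator_le[OF rp])
    also have "(\<Sum>j\<in>UNIV. LINT y|torus. \<bar>partial j ?rp y\<bar>) \<le> ?S p + ?S m"
      unfolding sum.distrib[symmetric]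
    proof (rule sum_mono)
      fix j
      have "partial j ?rp y = mollify p (G j) y - mollify m (G j) y" for y
        using partial_diff[OF mollify_trig[OF f] mollify_trig[OF f]] partial_mollify[OF f weak] by metis
      then have "(LINT y|torus. \<bar>partial j ?rp y\<bar>) = (LINT y|torus. \<bar>mollify p (G j) y - mollify m (G j) y\<bar>)"
        by simp
      also have "\<dots> \<le> (LINT y|torus. \<bar>mollify p (G j) y - G j y\<bar> + \<bar>mollify m (G j) y - G j y\<bar>)"
        using G mint by (intro integral_mono) auto
      also have "\<dots> = (LINT y|torus. \<bar>mollify p (G j) y - G j y\<bar>) + (LINT y|torus. \<bar>mollify m (G j) y - G j y\<bar>)"
        using G mint by simp
      finally show "(LINT y|torus. \<bar>partial j ?rp y\<bar>) \<le> (LINT y|torus. \<bar>mollify p (G j) y - G j y\<bar>) + (LINT y|torus. \<bar>mollify m (G j) y - G j y\<bar>)" .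
    qed
    finally show ?thesis using C_pos by (simp add: mult_left_mono)
  qed
  then show ?thesis by (intro LIMSEQ_le_const[OF lim]) blast
qed

text \<open>
  The commutator estimate of DiPerna and Lions. Write f as a trigonometric polynomial plus a
  remainder with small weak gradient, and u as a trigonometric polynomial plus a remainder that is
  small in mean. The first remainder contributes little, uniformly in n, by the previous
  estimate; the second because the smooth part of f supplies one factor of the distance; and for
  the smooth parts three factors of the distance are available: the first keeps the gradient of the kernel
  bounded in mean, the other two make it small.
\<close>

lemma W11_commutator_tendsto_0:
  assumes u[measurable]: "u \<in> borel_measurable torus" and uU: "\<And>x. \<bar>u x\<bar> \<le> U"
    and f: "integrable torus f" and G: "\<And>j. integrable torus (G j)" and weak: "\<And>j. weak_partial j f (G j)"
  shows "(\<lambda>n. \<integral>(x, y). (u x - u y)\<^sup>2 * (f x - f y) * partial i (K n) (x - y) \<partial>(torus \<Otimes>\<^sub>M torus)) \<longlonglongrightarrow> 0"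
    (is "?I \<longlonglongrightarrow> 0")
proof (rule LIMSEQ_I)
  fix e :: real assume e: "0 < e"
  have U: "0 \<le> U" using uU[of undefined] by linarith
  have ui: "integrable torus u" by (rule bounded_integrable_torus[OF u uU])
  note mint = trig_integrable[OF mollify_trig]
  define A where "A = sqrt CARD('n) / 2 * C"
  let ?S = "\<lambda>m. \<Sum>j\<in>UNIV. LINT y|torus. \<bar>mollify m (G j) y - G j y\<bar>"
  have "(\<lambda>m. 4 * U\<^sup>2 * (A * ?S m)) \<longlonglongrightarrow> 4 * U\<^sup>2 * (A * (\<Sum>j\<in>(UNIV :: 'n set). 0))"
    by (intro tendsto_intros mollify_tendsto_L1 G)
  then have "\<forall>\<^sub>F m in sequentially. 4 * U\<^sup>2 * (A * ?S m) < e / 3"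
    using e by (intro order_tendstoD(2)) auto
  then obtain m where m: "4 * U\<^sup>2 * (A * ?S m) < e / 3"
    by (meson eventually_happens trivial_limit_sequentially)
  define \<beta> where "\<beta> = mollify m f"
  define r where "r x = f x - \<beta> x" for x
  have \<beta>: "\<beta> \<in> trig" unfolding \<beta>_def by (rule mollify_trig[OF f])
  obtain L where L: "0 < L" "\<And>x y. \<bar>\<beta> x - \<beta> y\<bar> \<le> L * sqrt (gap (x - y))"
    using trig_gap_lipschitz[OF \<beta>] by blast
  let ?W = "\<lambda>p. LINT x|torus. \<bar>mollify p u x - u x\<bar>"
  have "(\<lambda>p. 16 * U * L * C * ?W p) \<longlonglongrightarrow> 16 * U * L * C * 0"
    by (intro tendsto_intros mollify_tendsto_L1 ui)
  then have "\<forall>\<^sub>F p in sequentially. 16 * U * L * C * ?W p < e / 3"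
    using e by (intro order_tendstoD(2)) auto
  then obtain p where p: "16 * U * L * C * ?W p < e / 3"
    by (meson eventually_happens trivial_limit_sequentially)
  define v where "v = mollify p u"
  define w where "w x = v x - u x" for x
  have v: "v \<in> trig" unfolding v_def by (rule mollify_trig[OF ui])
  have vU: "\<bar>v x\<bar> \<le> U" for x unfolding v_def by (rule mollify_bounded[OF ui uU])
  obtain L' where L': "0 < L'" "\<And>x y. \<bar>v x - v y\<bar> \<le> L' * sqrt (gap (x - y))"
    using trig_gap_lipschitz[OF v] by blast
  have rint: "integrable torus r" unfolding r_def[abs_def] using f trig_integrable[OF \<beta>] by simp
  have wint: "integrable torus (\<lambda>x. \<bar>w x\<bar>)" unfolding w_def[abs_def] using ui trig_integrable[OF v] by simp
  \<comment> \<open>The first two terms are already small and do not depend on n; only now n goes to infinity.\<close>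
  have bound: "\<bar>?I n\<bar> \<le> 4 * U\<^sup>2 * (A * ?S m) + 16 * U * L * C * ?W p + 2 * L'\<^sup>2 * L * C / Suc n" for n
  proof -
    let ?dK = "partial i (K n)"
    have dK: "?dK \<in> trig" by (rule trig_partial[OF K_trig])
    obtain B where B: "\<And>x. \<bar>H n x\<bar> \<le> B" using trig_bounded[OF H_trig] by blast
    have one: "integrable torus (\<lambda>x::real^'n. 1 :: real)" by simp
    note Hc = trig_continuous[OF H_trig] B
    define P where "P x y = 4 * U\<^sup>2 * (\<bar>r x - r y\<bar> * \<bar>?dK (x - y)\<bar>) + 2 * L'\<^sup>2 * L * C / Suc n * (1 * 1 * H n (x - y))
      + 8 * U * L * C * (\<bar>w x\<bar> * 1 * H n (x - y) + 1 * \<bar>w y\<bar> * H n (x - y))" for x y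
    note int = integrable_difference_mult_trig[OF rint dK] convolution_integrable[OF one one Hc]
      convolution_integrable[OF wint one Hc] convolution_integrable[OF one wint Hc]
    have Pint: "integrable (torus \<Otimes>\<^sub>M torus) (\<lambda>(x, y). P x y)"
      unfolding P_def using int by (simp add: case_prod_beta')
    have pointwise: "\<bar>(u x - u y)\<^sup>2 * (f x - f y) * ?dK (x - y)\<bar> \<le> P x y" for x y
    proof -
      define D \<rho> q where "D = \<bar>?dK (x - y)\<bar>" and "\<rho> = sqrt (gap (x - y))" and "q = (u x - u y)\<^sup>2"
      have D: "0 \<le> D" and \<rho>: "0 \<le> \<rho>" unfolding D_def \<rho>_def using gap_nonneg by simp_all
      have q: "0 \<le> q" "q \<le> 4 * U\<^sup>2"
      proof -
        have "\<bar>u x - u y\<bar> \<le> 2 * U" using uU[of x] uU[of y] by linarith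
        from power_mono[OF this abs_ge_zero, of 2] show "q \<le> 4 * U\<^sup>2"
          unfolding q_def by (simp add: power_mult_distrib)
      qed (simp add: q_def)
      have q': "q \<le> 2 * L'\<^sup>2 * \<rho>\<^sup>2 + 8 * U * (\<bar>w x\<bar> + \<bar>w y\<bar>)"
      proof -
        have "(v x - v y)\<^sup>2 \<le> (L' * \<rho>)\<^sup>2"
          using power_mono[OF L'(2)[of x y] abs_ge_zero, of 2] by (simp add: \<rho>_def)
        moreover have "(w x - w y)\<^sup>2 \<le> 4 * U * (\<bar>w x\<bar> + \<bar>w y\<bar>)"
        proof -
          have "\<bar>w x - w y\<bar> \<le> 4 * U" "\<bar>w x - w y\<bar> \<le> \<bar>w x\<bar> + \<bar>w y\<bar>"
            using uU[of x] uU[of y] vU[of x] vU[of y] unfolding w_def by linarith+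
          then have "\<bar>w x - w y\<bar> * \<bar>w x - w y\<bar> \<le> 4 * U * (\<bar>w x\<bar> + \<bar>w y\<bar>)"
            using U by (intro mult_mono) auto
          then show ?thesis by (simp add: power2_eq_square)
        qed
        moreover have "q \<le> 2 * (v x - v y)\<^sup>2 + 2 * (w x - w y)\<^sup>2"
        proof -
          have "u x - u y = (v x - v y) - (w x - w y)" by (simp add: w_def)
          moreover have "(s - t)\<^sup>2 \<le> 2 * s\<^sup>2 + 2 * t\<^sup>2" for s t :: real
            using zero_le_power2[of "s + t"] by (simp add: power2_eq_square algebra_simps)
          ultimately show ?thesis unfolding q_def by metis
        qed
        ultimately show ?thesis by (simp add: power_mult_distrib)
      qed
      have "\<bar>f x - f y\<bar> \<le> \<bar>r x - r y\<bar> + L * \<rho>"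
        using L(2)[of x y] unfolding r_def \<rho>_def by linarith
      then have "q * \<bar>f x - f y\<bar> * D \<le> q * (\<bar>r x - r y\<bar> + L * \<rho>) * D"
        using q D by (intro mult_right_mono mult_left_mono) auto
      also have "\<dots> = q * (\<bar>r x - r y\<bar> * D) + q * (L * (\<rho> * D))"
        by (simp add: algebra_simps)
      also have "\<dots> \<le> 4 * U\<^sup>2 * (\<bar>r x - r y\<bar> * D) + (2 * L'\<^sup>2 * \<rho>\<^sup>2 + 8 * U * (\<bar>w x\<bar> + \<bar>w y\<bar>)) * (L * (\<rho> * D))"
        using q q' D \<rho> L(1) by (intro add_mono mult_right_mono) auto
      also have "\<dots> = 4 * U\<^sup>2 * (\<bar>r x - r y\<bar> * D) + 2 * L'\<^sup>2 * L * (\<rho> ^ 3 * D) + 8 * U * L * (\<bar>w x\<bar> + \<bar>w y\<bar>) * (\<rho> * D)"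
        by (simp add: power2_eq_square power3_eq_cube algebra_simps)
      also have "\<dots> \<le> 4 * U\<^sup>2 * (\<bar>r x - r y\<bar> * D) + 2 * L'\<^sup>2 * L * (C / Suc n * H n (x - y)) + 8 * U * L * (\<bar>w x\<bar> + \<bar>w y\<bar>) * (C * H n (x - y))"
        unfolding D_def \<rho>_def using L(1) U
        by (intro add_mono order_refl mult_left_mono partial_K_gap partial_K_gap3) auto
      finally have "q * \<bar>f x - f y\<bar> * D \<le> P x y"
        unfolding P_def D_def by (simp add: algebra_simps)
      then show ?thesis unfolding q_def D_def by (simp add: abs_mult)
    qed
    have "\<bar>?I n\<bar> \<le> (\<integral>z. \<bar>case z of (x, y) \<Rightarrow> (u x - u y)\<^sup>2 * (f x - f y) * ?dK (x - y)\<bar> \<partial>(torus \<Otimes>\<^sub>M torus))"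
      by (rule integral_abs_bound)
    also have "\<dots> \<le> (\<integral>(x, y). P x y \<partial>(torus \<Otimes>\<^sub>M torus))"
    proof (rule integral_mono')
      show "integrable (torus \<Otimes>\<^sub>M torus) (\<lambda>(x, y). P x y)" by (rule Pint)
      show "\<bar>case z of (x, y) \<Rightarrow> (u x - u y)\<^sup>2 * (f x - f y) * ?dK (x - y)\<bar> \<le> (case z of (x, y) \<Rightarrow> P x y)" for z
        using pointwise by (cases z) simp
      show "0 \<le> (case z of (x, y) \<Rightarrow> P x y)" for z
        using order_trans[OF abs_ge_zero pointwise] by (cases z) simp
    qed
    also have "\<dots> = 4 * U\<^sup>2 * (\<integral>(x, y). \<bar>r x - r y\<bar> * \<bar>?dK (x - y)\<bar> \<partial>(torus \<Otimes>\<^sub>M torus))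
       + 2 * L'\<^sup>2 * L * C / Suc n * (\<integral>(x, y). 1 * 1 * H n (x - y) \<partial>(torus \<Otimes>\<^sub>M torus))
       + 8 * U * L * C * ((\<integral>(x, y). \<bar>w x\<bar> * 1 * H n (x - y) \<partial>(torus \<Otimes>\<^sub>M torus))
          + (\<integral>(x, y). 1 * \<bar>w y\<bar> * H n (x - y) \<partial>(torus \<Otimes>\<^sub>M torus)))"
      unfolding P_def using int by (simp add: case_prod_beta')
    also have "(\<integral>(x, y). 1 * 1 * H n (x - y) \<partial>(torus \<Otimes>\<^sub>M torus)) = 1"
      unfolding convolution_fst[OF one one Hc] by (simp add: H_mass_diff measure_torus)
    also have "(\<integral>(x, y). \<bar>w x\<bar> * 1 * H n (x - y) \<partial>(torus \<Otimes>\<^sub>M torus)) = ?W p"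
      unfolding convolution_fst[OF wint one Hc] by (simp add: H_mass_diff w_def v_def)
    also have "(\<integral>(x, y). 1 * \<bar>w y\<bar> * H n (x - y) \<partial>(torus \<Otimes>\<^sub>M torus)) = ?W p"
      unfolding convolution_snd[OF one wint Hc] by (simp add: H_mass_diff w_def v_def)
    also have "(\<integral>(x, y). \<bar>r x - r y\<bar> * \<bar>?dK (x - y)\<bar> \<partial>(torus \<Otimes>\<^sub>M torus)) \<le> A * ?S m"
      unfolding r_def \<beta>_def A_def by (rule W11_commutator_le[OF f G weak])
    finally show ?thesis by (simp add: mult_left_mono)
  qed
  have "(\<lambda>n. 2 * L'\<^sup>2 * L * C / Suc n) \<longlonglongrightarrow> 0"
    using LIMSEQ_Suc[OF lim_const_over_n[of "2 * L'\<^sup>2 * L * C"]] by simp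
  then have "\<forall>\<^sub>F n in sequentially. 2 * L'\<^sup>2 * L * C / Suc n < e / 3"
    using e by (intro order_tendstoD) auto
  then obtain N where N: "\<And>n. n \<ge> N \<Longrightarrow> 2 * L'\<^sup>2 * L * C / Suc n < e / 3"
    by (auto simp: eventually_sequentially)
  have "norm (?I n - 0) < e" if "n \<ge> N" for n
    using bound[of n] N[OF that] m p unfolding real_norm_def diff_0_right by linarith
  then show "\<exists>no. \<forall>n\<ge>no. norm (?I n - 0) < e" by blast
qed

end

section \<open>The energy identity and uniqueness\<close>

text \<open>
  Poincare's inequality weighted by the Fourier coefficients of the kernel. For one frequency
  both sides are multiples of the squared modulus of the corresponding Fourier coefficient of the
  function; every nonzero integer frequency has length at least one, and frequency zero
  contributes nothing because the mean is zero.
\<close>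

lemma pos_trig_poincare:
  assumes K: "K \<in> pos_trig" and u: "integrable torus u" "(LINT x|torus. u x) = 0"
  shows "4 * pi\<^sup>2 * (LINT x|torus. u x * (LINT y|torus. u y * K (x - y)))
    \<le> - (LINT x|torus. u x * (LINT y|torus. u y * laplacian K (x - y)))"
  using K
proof induction
  case (wave a k)
  define P where "P = (LINT y|torus. u y * wave k 0 y)"
  define Q where "Q = (LINT y|torus. u y * wave k (- pi / 2) y)"
  define N where "N = (\<Sum>i\<in>UNIV. (of_int (k i))\<^sup>2 :: real)"
  have int: "integrable torus (\<lambda>y. u y * wave k \<phi> y)" for \<phi>
    using integrable_mult_trig[OF trig.wave[of 1] u(1)] by simp
  have quad: "(LINT x|torus. u x * (LINT y|torus. u y * (c * wave k 0 (x - y)))) = c * (P\<^sup>2 + Q\<^sup>2)" for c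
  proof -
    have "(LINT x|torus. u x * (LINT y|torus. u y * (c * wave k 0 (x - y))))
      = (LINT x|torus. (c * P) * (u x * wave k 0 x) + (c * Q) * (u x * wave k (- pi / 2) x))"
      unfolding convolution_wave[OF u(1)] P_def Q_def by (simp add: algebra_simps)
    also have "\<dots> = c * P * P + c * Q * Q"
      using int by (simp add: P_def Q_def)
    finally show ?thesis by (simp add: power2_eq_square algebra_simps)
  qed
  have "wave k (pi / 2 + pi / 2) x = - wave k 0 x" for x
    unfolding wave_def by simp
  then have lap: "laplacian (\<lambda>x. a * wave k 0 x) x = (- (a * (4 * pi\<^sup>2 * N))) * wave k 0 x" for x
    unfolding laplacian_def partial_wave N_def
    by (simp add: sum_distrib_left sum_distrib_right sum_negf power2_eq_square mult_ac)
  have "N * (P\<^sup>2 + Q\<^sup>2) \<ge> P\<^sup>2 + Q\<^sup>2"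
  proof (cases "\<forall>i. k i = 0")
    case True
    then have "P = 0" "Q = 0"
      using u(2) unfolding P_def Q_def wave_def by simp_all
    then show ?thesis by simp
  next
    case False
    then obtain i where "k i \<noteq> 0" by blast
    then have "1 \<le> (of_int \<bar>k i\<bar> :: real)"
      by linarith
    then have "1 \<le> (of_int (k i))\<^sup>2 * (1::real)"
      using one_le_power[of "of_int \<bar>k i\<bar> :: real" 2] by simp
    also have "\<dots> \<le> N" unfolding N_def by simp (rule member_le_sum, auto)
    finally show ?thesis
      using mult_right_mono[of 1 N "P\<^sup>2 + Q\<^sup>2"] by simp
  qed
  then have "4 * pi\<^sup>2 * a * (P\<^sup>2 + Q\<^sup>2) \<le> 4 * pi\<^sup>2 * a * (N * (P\<^sup>2 + Q\<^sup>2))"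
    using wave by (intro mult_left_mono) auto
  then show ?case
    unfolding lap quad by (simp add: algebra_simps)
next
  case (add f g)
  note tr = add.hyps[THEN pos_trig_imp_trig]
  have split: "(LINT x|torus. u x * (LINT y|torus. u y * (K (x - y) + L (x - y))))
     = (LINT x|torus. u x * (LINT y|torus. u y * K (x - y))) + (LINT x|torus. u x * (LINT y|torus. u y * L (x - y)))"
    if "K \<in> trig" "L \<in> trig" for K L
  proof -
    have "(LINT y|torus. u y * (K (x - y) + L (x - y))) = (LINT y|torus. u y * K (x - y)) + (LINT y|torus. u y * L (x - y))" for x
      using integrable_mult_trig[OF trig_reflect_shift[OF that(1)] u(1)]
        integrable_mult_trig[OF trig_reflect_shift[OF that(2)] u(1)]
      by (simp add: distrib_left)
    then show ?thesis
      using integrable_mult_trig[OF trig_convolution[OF u(1) that(1)] u(1)]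
        integrable_mult_trig[OF trig_convolution[OF u(1) that(2)] u(1)]
      by (simp add: distrib_left)
  qed
  have lap: "laplacian (\<lambda>x. f x + g x) = (\<lambda>x. laplacian f x + laplacian g x)"
    unfolding laplacian_def using tr by (simp add: partial_add trig_partial sum.distrib)
  note split = split[OF tr] split[OF trig_laplacian[OF tr(1)] trig_laplacian[OF tr(2)]]
  show ?case
    unfolding lap split using add.IH by (simp add: distrib_left)
qed

text \<open>
  The integrand is T(x,y) + T(y,x), where T collects the terms with b(x), because the gradient of an even kernel
  is odd. Expanding the square in T, the terms without a product of both values of u vanish: one since
  the gradient of the kernel has mean zero, the other since b is divergence free. The mixed term is the
  equation for u tested with the translated kernel.
\<close>

lemma integral_antisymmetrized_transport:
  fixes K :: "real^'n \<Rightarrow> real" and b :: "'n \<Rightarrow> real^'n \<Rightarrow> real"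
  assumes K: "K \<in> pos_trig"
    and u[measurable]: "u \<in> borel_measurable torus" and uU: "\<And>x. \<bar>u x\<bar> \<le> U"
    and b: "\<And>i. integrable torus (b i)"
    and div_free: "\<And>\<phi>. \<phi> \<in> trig \<Longrightarrow> (\<Sum>i\<in>UNIV. LINT x|torus. b i x * partial i \<phi> x) = 0"
    and eqn: "\<And>\<phi>. \<phi> \<in> trig \<Longrightarrow> (\<Sum>i\<in>UNIV. LINT x|torus. u x * b i x * partial i \<phi> x) = (LINT x|torus. u x * laplacian \<phi> x)"
  shows "(\<Sum>i\<in>UNIV. \<integral>(x, y). (u x - u y)\<^sup>2 * (b i x - b i y) * partial i K (x - y) \<partial>(torus \<Otimes>\<^sub>M torus))
    = - 4 * (LINT y|torus. u y * (LINT x|torus. u x * laplacian K (x - y)))"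
proof -
  have Kt: "K \<in> trig" by (rule pos_trig_imp_trig[OF K])
  note dK = trig_partial[OF Kt]
  have u2: "\<bar>(u x)\<^sup>2\<bar> \<le> U\<^sup>2" for x
    using power_mono[OF uU[of x] abs_ge_zero, of 2] by simp
  have [simp]: "integrable torus u" "integrable torus (\<lambda>x. (u x)\<^sup>2)"
    by (rule bounded_integrable_torus[OF u uU], rule bounded_integrable_torus[OF _ u2]) measurable
  have ub: "integrable torus (\<lambda>x. b i x * u x)" and u2b: "integrable torus (\<lambda>x. b i x * (u x)\<^sup>2)" for i
    using integrable_mult_bounded[OF b u uU] integrable_mult_bounded[OF b _ u2] by simp_all
  have one: "integrable torus (\<lambda>x::real^'n. 1 :: real)" by simp
  define T where "T i x y = b i x * (u x)\<^sup>2 * 1 * partial i K (x - y) - 2 * (b i x * u x * u y * partial i K (x - y))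
     + b i x * (u y)\<^sup>2 * partial i K (x - y)" for i x y
  have each: "(\<integral>(x, y). (u x - u y)\<^sup>2 * (b i x - b i y) * partial i K (x - y) \<partial>(torus \<Otimes>\<^sub>M torus))
    = - 4 * (LINT y|torus. u y * (LINT x|torus. b i x * u x * partial i K (x - y)))
      + 2 * (LINT y|torus. (u y)\<^sup>2 * (LINT x|torus. b i x * partial i K (x - y)))" for i
  proof -
    obtain B where B: "\<And>x. \<bar>partial i K x\<bar> \<le> B" using trig_bounded[OF dK] by blast
    note c = trig_continuous[OF dK] B
    note int = convolution_integrable[OF u2b one c] convolution_integrable[OF ub _ c, of u] convolution_integrable[OF b _ c, of "\<lambda>y. (u y)\<^sup>2"]
    have Tint: "integrable (torus \<Otimes>\<^sub>M torus) (\<lambda>(x, y). T i x y)"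
      unfolding T_def using int by (simp add: case_prod_beta')
    have Tval: "(\<integral>(x, y). T i x y \<partial>(torus \<Otimes>\<^sub>M torus))
      = - 2 * (LINT y|torus. u y * (LINT x|torus. b i x * u x * partial i K (x - y)))
        + (LINT y|torus. (u y)\<^sup>2 * (LINT x|torus. b i x * partial i K (x - y)))"
    proof -
      have "(\<integral>(x, y). T i x y \<partial>(torus \<Otimes>\<^sub>M torus))
       = (\<integral>(x, y). b i x * (u x)\<^sup>2 * 1 * partial i K (x - y) \<partial>(torus \<Otimes>\<^sub>M torus))
         - 2 * (\<integral>(x, y). b i x * u x * u y * partial i K (x - y) \<partial>(torus \<Otimes>\<^sub>M torus))
         + (\<integral>(x, y). b i x * (u y)\<^sup>2 * partial i K (x - y) \<partial>(torus \<Otimes>\<^sub>M torus))"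
        unfolding T_def using int by (simp add: case_prod_beta')
      also have "(\<integral>(x, y). b i x * (u x)\<^sup>2 * 1 * partial i K (x - y) \<partial>(torus \<Otimes>\<^sub>M torus)) = 0"
        unfolding convolution_fst[OF u2b one c]
        by (simp add: integral_trig_diff_snd[OF dK] integral_partial_trig[OF Kt])
      finally show ?thesis
        using convolution_snd[OF ub _ c, of u] convolution_snd[OF b _ c, of "\<lambda>y. (u y)\<^sup>2"] by simp
    qed
    have "(u x - u y)\<^sup>2 * (b i x - b i y) * partial i K (x - y) = T i x y + T i y x" for x y
      using partial_even_odd[OF K, of i "x - y"] by (simp add: T_def power2_eq_square algebra_simps)
    then have "(\<integral>(x, y). (u x - u y)\<^sup>2 * (b i x - b i y) * partial i K (x - y) \<partial>(torus \<Otimes>\<^sub>M torus))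
      = (\<integral>(x, y). T i x y \<partial>(torus \<Otimes>\<^sub>M torus)) + (\<integral>(x, y). T i y x \<partial>(torus \<Otimes>\<^sub>M torus))"
      using Tint torus2.integrable_product_swap[OF Tint] by (simp add: case_prod_beta')
    also have "(\<integral>(x, y). T i y x \<partial>(torus \<Otimes>\<^sub>M torus)) = (\<integral>(x, y). T i x y \<partial>(torus \<Otimes>\<^sub>M torus))"
      using torus2.integral_product_swap[of "\<lambda>(x, y). T i x y"] Tint by auto
    finally show ?thesis unfolding Tval by simp
  qed
  have conv_int: "integrable torus (\<lambda>y. w y * (LINT x|torus. f x * partial i K (x - y)))"
    if f: "integrable torus f" and w: "integrable torus w" for f w i
  proof -
    have "(\<lambda>y. LINT x|torus. f x * (\<lambda>z. partial i K (- z)) (y - x)) \<in> trig"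
      by (rule trig_convolution[OF f trig_reflect[OF dK]])
    then show ?thesis
      using integrable_mult_trig[OF _ w] by simp
  qed
  have dphi: "(\<lambda>x. K (x - y)) \<in> trig" for y
    using trig_shift[OF Kt, of "- y"] by simp
  have div0: "(\<Sum>i\<in>UNIV. LINT x|torus. b i x * partial i K (x - y)) = 0" for y
    using div_free[OF dphi, of y] unfolding partial_shift[OF Kt] .
  have eqn0: "(\<Sum>i\<in>UNIV. LINT x|torus. b i x * u x * partial i K (x - y)) = (LINT x|torus. u x * laplacian K (x - y))" for y
  proof -
    have "laplacian (\<lambda>x. K (x - y)) = (\<lambda>x. laplacian K (x - y))"
      unfolding laplacian_def partial_shift[OF Kt] partial_shift[OF dK] ..
    then show ?thesis
      using eqn[OF dphi, of y] unfolding partial_shift[OF Kt] by (simp add: mult_ac)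
  qed
  have "(\<Sum>i\<in>UNIV. \<integral>(x, y). (u x - u y)\<^sup>2 * (b i x - b i y) * partial i K (x - y) \<partial>(torus \<Otimes>\<^sub>M torus))
    = - 4 * (LINT y|torus. u y * (\<Sum>i\<in>UNIV. LINT x|torus. b i x * u x * partial i K (x - y)))
      + 2 * (LINT y|torus. (u y)\<^sup>2 * (\<Sum>i\<in>UNIV. LINT x|torus. b i x * partial i K (x - y)))"
  proof -
    have "(LINT y|torus. w y * (\<Sum>i\<in>UNIV. LINT x|torus. f i x * partial i K (x - y)))
      = (\<Sum>i\<in>UNIV. LINT y|torus. w y * (LINT x|torus. f i x * partial i K (x - y)))"
      if "\<And>i. integrable torus (f i)" "integrable torus w" for f w
      unfolding sum_distrib_left by (intro Bochner_Integration.integral_sum conv_int that)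
    from this[OF ub] this[OF b] show ?thesis
      unfolding each by (simp only: sum.distrib sum_distrib_left[symmetric]) simp
  qed
  then show ?thesis unfolding div0 eqn0 by simp
qed

context mollifier
begin

text \<open>
  The identity above equates the commutator with the quadratic form of the Laplacian of the kernel, which by
  the weighted Poincare inequality dominates the quadratic form of the kernel itself. The former tends to
  zero and the latter to the squared norm of u.
\<close>

lemma bounded_solution_eq_0:
  fixes b :: "'n \<Rightarrow> real^'n \<Rightarrow> real" and G :: "'n \<Rightarrow> 'n \<Rightarrow> real^'n \<Rightarrow> real"
  assumes u[measurable]: "u \<in> borel_measurable torus" and uU: "\<And>x. \<bar>u x\<bar> \<le> U"
    and mean: "(LINT x|torus. u x) = 0"
    and b: "\<And>i. integrable torus (b i)" and G: "\<And>i j. integrable torus (G i j)"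
    and weak: "\<And>i j. weak_partial j (b i) (G i j)"
    and div_free: "\<And>\<phi>. \<phi> \<in> trig \<Longrightarrow> (\<Sum>i\<in>UNIV. LINT x|torus. b i x * partial i \<phi> x) = 0"
    and eqn: "\<And>\<phi>. \<phi> \<in> trig \<Longrightarrow> (\<Sum>i\<in>UNIV. LINT x|torus. u x * b i x * partial i \<phi> x) = (LINT x|torus. u x * laplacian \<phi> x)"
  shows "AE x in torus. u x = 0"
proof -
  have U: "0 \<le> U" using uU[of undefined] by linarith
  have ui: "integrable torus u" by (rule bounded_integrable_torus[OF u uU])
  note mint = trig_integrable[OF mollify_trig]
  have u2: "integrable torus (\<lambda>x. (u x)\<^sup>2)"
    using integrable_mult_bounded[OF ui u uU] by (simp add: power2_eq_square)
  let ?I = "\<lambda>n. \<Sum>i\<in>UNIV. \<integral>(x, y). (u x - u y)\<^sup>2 * (b i x - b i y) * partial i (K n) (x - y) \<partial>(torus \<Otimes>\<^sub>M torus)"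
  let ?q = "\<lambda>n. LINT x|torus. u x * mollify n u x"
  have "?I \<longlonglongrightarrow> (\<Sum>i\<in>(UNIV :: 'n set). 0)"
    by (intro tendsto_sum W11_commutator_tendsto_0[OF u uU b G weak])
  then have "(\<lambda>n. ?I n / 4 - U * (4 * pi\<^sup>2) * - (LINT x|torus. \<bar>mollify n u x - u x\<bar>)) \<longlonglongrightarrow> 0 / 4 - U * (4 * pi\<^sup>2) * - 0"
    by (intro tendsto_intros mollify_tendsto_L1 ui) simp_all
  moreover have "4 * pi\<^sup>2 * (LINT x|torus. (u x)\<^sup>2) \<le> ?I n / 4 - U * (4 * pi\<^sup>2) * - (LINT x|torus. \<bar>mollify n u x - u x\<bar>)" for n
  proof -
    have "(LINT x|torus. (u x)\<^sup>2) \<le> (LINT x|torus. u x * mollify n u x + U * \<bar>mollify n u x - u x\<bar>)"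
    proof (rule integral_mono[OF u2])
      show "integrable torus (\<lambda>x. u x * mollify n u x + U * \<bar>mollify n u x - u x\<bar>)"
        using ui mint[OF ui] integrable_mult_trig[OF mollify_trig[OF ui] ui] by simp
      fix x
      define t where "t = mollify n u x - u x"
      have "- (u x * t) \<le> \<bar>u x\<bar> * \<bar>t\<bar>"
        unfolding abs_mult[symmetric] by (rule abs_ge_minus_self)
      also have "\<dots> \<le> U * \<bar>t\<bar>"
        by (intro mult_right_mono uU) simp
      finally have "0 \<le> u x * t + U * \<bar>t\<bar>" by simp
      moreover have "u x * mollify n u x = (u x)\<^sup>2 + u x * t"
        by (simp add: t_def power2_eq_square right_diff_distrib)
      ultimately show "(u x)\<^sup>2 \<le> u x * mollify n u x + U * \<bar>mollify n u x - u x\<bar>"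
        unfolding t_def[symmetric] by simp
    qed
    also have "\<dots> = ?q n + U * (LINT x|torus. \<bar>mollify n u x - u x\<bar>)"
      using ui mint[OF ui] integrable_mult_trig[OF mollify_trig[OF ui] ui] by simp
    finally have "4 * pi\<^sup>2 * (LINT x|torus. (u x)\<^sup>2) \<le> 4 * pi\<^sup>2 * (?q n + U * (LINT x|torus. \<bar>mollify n u x - u x\<bar>))"
      by (intro mult_left_mono) auto
    also have "\<dots> = 4 * pi\<^sup>2 * ?q n + 4 * pi\<^sup>2 * (U * (LINT x|torus. \<bar>mollify n u x - u x\<bar>))"
      by (rule distrib_left)
    also have "4 * pi\<^sup>2 * ?q n \<le> - (LINT x|torus. u x * (LINT y|torus. u y * laplacian (K n) (x - y)))"
      unfolding mollify_def by (rule pos_trig_poincare[OF K_pos_trig ui mean])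
    also have "(LINT x|torus. u x * (LINT y|torus. u y * laplacian (K n) (x - y)))
      = (LINT y|torus. u y * (LINT x|torus. u x * laplacian (K n) (x - y)))"
    proof -
      have lap: "laplacian (K n) \<in> trig" by (rule trig_laplacian[OF K_trig])
      obtain B where B: "\<And>x. \<bar>laplacian (K n) x\<bar> \<le> B" using trig_bounded[OF lap] by blast
      show ?thesis
        using convolution_fst[OF ui ui trig_continuous[OF lap] B] convolution_snd[OF ui ui trig_continuous[OF lap] B]
        by simp
    qed
    also have "- \<dots> = ?I n / 4"
      using integral_antisymmetrized_transport[OF K_pos_trig u uU b div_free eqn, of n] by simp
    finally show ?thesis by (simp add: mult_ac)
  qed
  ultimately have "4 * pi\<^sup>2 * (LINT x|torus. (u x)\<^sup>2) \<le> 0 / 4 - U * (4 * pi\<^sup>2) * - 0"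
    by (intro LIMSEQ_le_const) blast+
  then have "(LINT x|torus. (u x)\<^sup>2) \<le> 0"
    by (simp add: mult_le_0_iff)
  moreover have "0 \<le> (LINT x|torus. (u x)\<^sup>2)" by simp
  ultimately have "(LINT x|torus. (u x)\<^sup>2) = 0" by linarith
  then show ?thesis
    using integral_nonneg_eq_0_iff_AE[OF u2] by simp
qed

end

text \<open>
  What remains is to modify u on a null set so that it is bounded everywhere, and to pass from vector
  fields to components.
\<close>

theorem theorem5:
  fixes b :: "real^'n \<Rightarrow> real^'n" and u :: "real^'n \<Rightarrow> real"
  assumes "CARD('n) \<ge> 2"
    and "b \<in> W_1_1"
    and "weakly_div_free b"
    and "u \<in> L_infinity"
    and "(LINT x|torus. u x) = 0"
    and "\<forall>\<phi>\<in>C_infinity.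
           (LINT x|torus. - u x * laplacian \<phi> x + (u x *\<^sub>R b x) \<bullet> grad \<phi> x) = 0"
  shows "AE x in torus. u x = 0"
proof -
  obtain K H :: "nat \<Rightarrow> real^'n \<Rightarrow> real" and C where "mollifier K H C"
    using mollifier_exists by blast
  then interpret mollifier K H C .
  have b: "integrable torus b" and "\<forall>j. \<exists>g\<in>L_1. weak_partial j b g"
    using assms(2) unfolding W_1_1_def L_1_def by auto
  then obtain g where g: "\<And>j. integrable torus (g j)" and weak: "\<And>j. weak_partial j b (g j)"
    unfolding L_1_def by (metis (no_types, lifting) mem_Collect_eq)
  obtain U where um[measurable]: "u \<in> borel_measurable torus" and uU: "AE x in torus. \<bar>u x\<bar> \<le> U" and U: "0 \<le> U"
  proof -
    from assms(4) obtain B where "u \<in> borel_measurable torus" "AE x in torus. \<bar>u x\<bar> \<le> B"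
      unfolding L_infinity_def by auto
    moreover from this(2) have "AE x in torus. \<bar>u x\<bar> \<le> max 0 B" by (auto elim: eventually_mono)
    ultimately show ?thesis using that[of "max 0 B"] by simp
  qed
  define v where "v x = (if \<bar>u x\<bar> \<le> U then u x else 0)" for x
  have vm[measurable]: "v \<in> borel_measurable torus" unfolding v_def[abs_def] by measurable
  have vU: "\<bar>v x\<bar> \<le> U" for x unfolding v_def using U by simp
  have uv: "AE x in torus. u x = v x" using uU by eventually_elim (simp add: v_def)
  note vi = bounded_integrable_torus[OF vm vU]
  have comp: "integrable torus (\<lambda>x. f x $ i)" if "integrable torus f" for f :: "real^'n \<Rightarrow> real^'n" and i
    using integrable_bounded_linear[OF bounded_linear_vec_nth that] .
  have comp_eq: "(LINT x|torus. f x) $ i = (LINT x|torus. f x $ i)" if "integrable torus f" for f :: "real^'n \<Rightarrow> real^'n" and i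
    using integral_bounded_linear[OF bounded_linear_vec_nth that] by simp
  have [measurable]: "(\<lambda>x. b x $ i) \<in> borel_measurable torus" for i using comp[OF b] by auto
  have "AE x in torus. v x = 0"
  proof (rule bounded_solution_eq_0[OF vm vU])
    show "(LINT x|torus. v x) = 0"
      using assms(5) integral_cong_AE[OF um vm uv] by simp
    show "integrable torus (\<lambda>x. b x $ i)" for i by (rule comp[OF b])
    show "integrable torus (\<lambda>x. g j x $ i)" for i j by (rule comp[OF g])
    show "weak_partial j (\<lambda>x. b x $ i) (\<lambda>x. g j x $ i)" for i j
      unfolding weak_partial_def
    proof
      fix \<phi> :: "real^'n \<Rightarrow> real" assume \<phi>: "\<phi> \<in> C_infinity"
      show "(LINT x|torus. partial j \<phi> x *\<^sub>R (b x $ i)) = - (LINT x|torus. \<phi> x *\<^sub>R (g j x $ i))"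
      proof -
        have diff: "foldr partial is \<phi> differentiable at x" for "is" x
          using \<phi> unfolding C_infinity_def by blast
        have c: "continuous_on UNIV \<phi>" "continuous_on UNIV (partial j \<phi>)"
          using diff[of "[]"] diff[of "[j]"]
          by (auto intro!: continuous_at_imp_continuous_on differentiable_imp_continuous_within)
        have "(LINT x|torus. partial j \<phi> x *\<^sub>R b x) $ i = - (LINT x|torus. \<phi> x *\<^sub>R g j x) $ i"
          using weak[of j] \<phi> unfolding weak_partial_def by simp
        then show ?thesis
          by (simp add: comp_eq continuous_scaleR_integrable c b g)
      qed
    qed
    fix \<phi> :: "real^'n \<Rightarrow> real" assume \<phi>: "\<phi> \<in> trig"
    note [measurable] = trig_integrands_measurable[OF \<phi>]
    note bint = integrable_mult_trig[OF trig_partial[OF \<phi>] comp[OF b]]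
    have dot: "c \<bullet> grad \<phi> x = (\<Sum>i\<in>UNIV. c $ i * partial i \<phi> x)" for c x
      by (simp add: inner_vec_def grad_def)
    show "(\<Sum>i\<in>UNIV. LINT x|torus. b x $ i * partial i \<phi> x) = 0"
    proof -
      have "(LINT x|torus. b x \<bullet> grad \<phi> x) = 0"
        using assms(3) trig_C_infinity[OF \<phi>] unfolding weakly_div_free_def by blast
      then show ?thesis
        unfolding dot by (subst (asm) Bochner_Integration.integral_sum) (use bint in auto)
    qed
    have vb: "integrable torus (\<lambda>x. v x * (b x $ i) * partial i \<phi> x)" for i
      using integrable_mult_bounded[OF bint vm vU] by (simp add: mult_ac)
    have vl: "integrable torus (\<lambda>x. v x * laplacian \<phi> x)"
      by (rule integrable_mult_trig[OF trig_laplacian[OF \<phi>] vi])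
    have "0 = (LINT x|torus. - u x * laplacian \<phi> x + (u x *\<^sub>R b x) \<bullet> grad \<phi> x)"
      using assms(6)[rule_format, OF trig_C_infinity[OF \<phi>]] by (rule sym)
    also have "\<dots> = (LINT x|torus. - u x * laplacian \<phi> x + (\<Sum>i\<in>UNIV. u x * (b x $ i) * partial i \<phi> x))"
      unfolding dot by simp
    also have "\<dots> = (LINT x|torus. - v x * laplacian \<phi> x + (\<Sum>i\<in>UNIV. v x * (b x $ i) * partial i \<phi> x))"
      by (rule integral_cong_AE) (use uv in \<open>auto elim: eventually_mono\<close>)
    also have "\<dots> = - (LINT x|torus. v x * laplacian \<phi> x) + (\<Sum>i\<in>UNIV. LINT x|torus. v x * (b x $ i) * partial i \<phi> x)"
      using vb vl by (simp add: Bochner_Integration.integral_sum)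
    finally show "(\<Sum>i\<in>UNIV. LINT x|torus. v x * (b x $ i) * partial i \<phi> x) = (LINT x|torus. v x * laplacian \<phi> x)"
      by simp
  qed
  with uv show ?thesis by eventually_elim simp
qed

end
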